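(* Let $\Bbbk$ be a field of characteristic zero, let $R=\Bbbk[x_1,\ldots,x_n]$ with its standard grading and with $\mathfrak{S}_n$ acting by permuting the variables, and let $\mathfrak{m}=(x_1,\ldots,x_n)$. Let $I\subseteq R$ be a homogeneous $\mathfrak{S}_n$-stable complete intersection ideal. Assume that, as a graded $\mathfrak{S}_n$-representation, $I/\mathfrak{m}I$ is isomorphic to a direct sum of $m\geqslant 1$ trivial representations in degrees $c_1,\ldots,c_m$. Then the graded character of $R/I$ is $$\chi_{R/I}=\chi_R\prod_{i=1}^m(1-t^{c_i}).$$
   Context: The group $\mathfrak{S}_n$ acts on $R$ by $\Bbbk$-algebra automorphisms permuting the variables, $\sigma\cdot x_i=x_{\sigma(i)}$. An ideal of $R$ is called a complete intersection ideal if it is generated by a regular sequence. Let $\mathcal{C}$ be the commutative ring of $\Bbbk$-valued class functions on $\mathfrak{S}_n$ under pointwise addition and multiplication; its identity is the trivial character. For a graded $\mathfrak{S}_n$-representation $V=\bigoplus_{d\geqslant 0}V_d$ over $\Bbbk$ with finite-dimensional components, the graded character of $V$ is $\chi_V=\sum_{d}\chi_{V_d}t^d\in\mathcal{C}[[t]]$, where $\chi_{V_d}$ is the character of $V_d$. $R$, $I/\mathfrak{m}I$ and $R/I$ carry the induced gradings and $\mathfrak{S}_n$-actions; the displayed equality is in $\mathcal{C}[[t]]$. A representation "in degree $c$" is a graded representation concentrated in degree $c$. *)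

theory Defs
  imports
    "HOL-Library.Poly_Mapping"
    "HOL-Library.FuncSet"
    "HOL-Combinatorics.Perm"
    "HOL-Computational_Algebra.Formal_Power_Series"
    "HOL-Algebra.Module"
    "HOL-Algebra.Ideal_Product"
begin

unbundle permutation_syntax

text \<open>
  The variables are indexed by a finite type \<open>'n\<close>, so \<open>n = CARD('n)\<close>, and the symmetric group on
  \<open>n\<close> letters is the type \<open>'n perm\<close> of all permutations of \<open>'n\<close>, with composition
  \<open>(\<sigma> * \<tau>) \<langle>$\<rangle> i = \<sigma> \<langle>$\<rangle> (\<tau> \<langle>$\<rangle> i)\<close> as multiplication.
\<close>

type_synonym ('n, 'k) mpoly = "('n \<Rightarrow>\<^sub>0 nat) \<Rightarrow>\<^sub>0 'k"

definition Const :: "'k::field_char_0 \<Rightarrow> ('n, 'k) mpoly" where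
  "Const c = Poly_Mapping.single 0 c"

definition Var :: "'n \<Rightarrow> ('n, 'k::field_char_0) mpoly" where
  "Var i = Poly_Mapping.single (Poly_Mapping.single i 1) 1"

definition mon_degree :: "('n::finite \<Rightarrow>\<^sub>0 nat) \<Rightarrow> nat" where
  "mon_degree a = (\<Sum>i\<in>UNIV. Poly_Mapping.lookup a i)"

definition homogeneous_polys :: "nat \<Rightarrow> ('n::finite, 'k::field_char_0) mpoly set" where
  "homogeneous_polys d = {p. \<forall>a\<in>Poly_Mapping.keys p. mon_degree a = d}"

definition homogeneous_component ::
    "nat \<Rightarrow> ('n::finite, 'k::field_char_0) mpoly \<Rightarrow> ('n, 'k) mpoly" where
  "homogeneous_component d p =
     (\<Sum>a | a \<in> Poly_Mapping.keys p \<and> mon_degree a = d.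
        Poly_Mapping.single a (Poly_Mapping.lookup p a))"

text \<open>Substitution of \<open>x\<^bsub>\<sigma>(i)\<^esub>\<close> for \<open>x\<^sub>i\<close>, i.e. the \<open>'k\<close>-algebra map with \<open>\<sigma> \<cdot> x\<^sub>i = x\<^bsub>\<sigma>(i)\<^esub>\<close>.\<close>

definition perm_vars ::
    "'n::finite perm \<Rightarrow> ('n, 'k::field_char_0) mpoly \<Rightarrow> ('n, 'k) mpoly" where
  "perm_vars \<sigma> p =
     (\<Sum>a\<in>Poly_Mapping.keys p.
        Const (Poly_Mapping.lookup p a) * (\<Prod>i\<in>UNIV. Var (\<sigma> \<langle>$\<rangle> i) ^ Poly_Mapping.lookup a i))"


section \<open>Graded representations of the symmetric group\<close>

text \<open>
  The underlying vector space is a HOL-Algebra module record over the field \<open>'k\<close>. The fields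
  \<open>mult\<close> and \<open>one\<close>, which every module record carries, have no meaning for a general
  representation; for the polynomial ring they are its ring structure.
\<close>

record ('n, 'k, 'v) graded_rep = "('k, 'v) module" +
  gact :: "'n perm \<Rightarrow> 'v \<Rightarrow> 'v"
  gcomp :: "nat \<Rightarrow> 'v set"

definition poly_ring :: "('n::finite, 'k::field_char_0, ('n, 'k) mpoly) graded_rep" where
  "poly_ring =
     \<lparr>carrier = UNIV, mult = (*), one = 1, zero = 0, add = (+), smult = (\<lambda>c p. Const c * p),
      gact = perm_vars, gcomp = homogeneous_polys\<rparr>"

definition sub_rep :: "('n, 'k, 'v) graded_rep \<Rightarrow> 'v set \<Rightarrow> ('n, 'k, 'v) graded_rep" where
  "sub_rep V U = V\<lparr>carrier := U, gcomp := (\<lambda>d. U \<inter> gcomp V d)\<rparr>"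

definition quot_rep :: "('n, 'k, 'v) graded_rep \<Rightarrow> 'v set \<Rightarrow> ('n, 'k, 'v set) graded_rep" where
  "quot_rep V U =
     \<lparr>carrier = a_rcosets\<^bsub>V\<^esub> U, mult = undefined, one = undefined, zero = U, add = set_add V,
      smult = (\<lambda>c X. \<Union>x\<in>X. U +>\<^bsub>V\<^esub> (c \<odot>\<^bsub>V\<^esub> x)),
      gact = (\<lambda>\<sigma> X. \<Union>x\<in>X. U +>\<^bsub>V\<^esub> gact V \<sigma> x),
      gcomp = (\<lambda>d. (\<lambda>x. U +>\<^bsub>V\<^esub> x) ` gcomp V d)\<rparr>"

definition trivial_rep :: "nat \<Rightarrow> ('n, 'k::field_char_0, 'k) graded_rep" where
  "trivial_rep c =
     \<lparr>carrier = UNIV, mult = undefined, one = undefined, zero = 0, add = (+), smult = (*),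
      gact = (\<lambda>\<sigma> x. x), gcomp = (\<lambda>d. if d = c then UNIV else {0})\<rparr>"

definition direct_sum_rep ::
    "'i set \<Rightarrow> ('i \<Rightarrow> ('n, 'k, 'v) graded_rep) \<Rightarrow> ('n, 'k, 'i \<Rightarrow> 'v) graded_rep" where
  \<comment> \<open>intended for finite index sets \<open>J\<close> only\<close>
  "direct_sum_rep J V =
     \<lparr>carrier = (\<Pi>\<^sub>E j\<in>J. carrier (V j)), mult = undefined, one = undefined,
      zero = (\<lambda>j\<in>J. \<zero>\<^bsub>V j\<^esub>), add = (\<lambda>x y. \<lambda>j\<in>J. x j \<oplus>\<^bsub>V j\<^esub> y j),
      smult = (\<lambda>a x. \<lambda>j\<in>J. a \<odot>\<^bsub>V j\<^esub> x j),
      gact = (\<lambda>\<sigma> x. \<lambda>j\<in>J. gact (V j) \<sigma> (x j)),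
      gcomp = (\<lambda>d. \<Pi>\<^sub>E j\<in>J. gcomp (V j) d)\<rparr>"

definition graded_rep_iso :: "('n, 'k, 'v) graded_rep \<Rightarrow> ('n, 'k, 'w) graded_rep \<Rightarrow> bool" where
  "graded_rep_iso V W \<longleftrightarrow>
     (\<exists>\<phi>. bij_betw \<phi> (carrier V) (carrier W) \<and>
          (\<forall>x\<in>carrier V. \<forall>y\<in>carrier V. \<phi> (x \<oplus>\<^bsub>V\<^esub> y) = \<phi> x \<oplus>\<^bsub>W\<^esub> \<phi> y) \<and>
          (\<forall>a. \<forall>x\<in>carrier V. \<phi> (a \<odot>\<^bsub>V\<^esub> x) = a \<odot>\<^bsub>W\<^esub> \<phi> x) \<and>
          (\<forall>\<sigma>. \<forall>x\<in>carrier V. \<phi> (gact V \<sigma> x) = gact W \<sigma> (\<phi> x)) \<and>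
          (\<forall>d. \<phi> ` gcomp V d = gcomp W d))"


section \<open>Class functions and graded characters\<close>

typedef ('n, 'k) class_fun =
    "{f :: 'n perm \<Rightarrow> 'k. \<forall>\<sigma> \<tau>. f (\<tau> * \<sigma> * inverse \<tau>) = f \<sigma>}"
  by auto

setup_lifting type_definition_class_fun

instantiation class_fun :: (type, comm_ring_1) comm_ring_1
begin

lift_definition zero_class_fun :: "('a, 'b) class_fun" is "\<lambda>_. 0" by simp
lift_definition one_class_fun :: "('a, 'b) class_fun" is "\<lambda>_. 1" by simp
lift_definition plus_class_fun :: "('a, 'b) class_fun \<Rightarrow> ('a, 'b) class_fun \<Rightarrow> ('a, 'b) class_fun"
  is "\<lambda>f g \<sigma>. f \<sigma> + g \<sigma>" by simp
lift_definition minus_class_fun :: "('a, 'b) class_fun \<Rightarrow> ('a, 'b) class_fun \<Rightarrow> ('a, 'b) class_fun"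
  is "\<lambda>f g \<sigma>. f \<sigma> - g \<sigma>" by simp
lift_definition uminus_class_fun :: "('a, 'b) class_fun \<Rightarrow> ('a, 'b) class_fun"
  is "\<lambda>f \<sigma>. - f \<sigma>" by simp
lift_definition times_class_fun :: "('a, 'b) class_fun \<Rightarrow> ('a, 'b) class_fun \<Rightarrow> ('a, 'b) class_fun"
  is "\<lambda>f g \<sigma>. f \<sigma> * g \<sigma>" by simp

instance
  by standard (transfer; simp add: algebra_simps fun_eq_iff)+

end

definition lincomb :: "('n, 'k, 'v) graded_rep \<Rightarrow> ('v \<Rightarrow> 'k) \<Rightarrow> 'v set \<Rightarrow> 'v" where
  "lincomb V a B = (\<Oplus>\<^bsub>V\<^esub>b\<in>B. a b \<odot>\<^bsub>V\<^esub> b)"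

definition finite_basis :: "('n, 'k, 'v) graded_rep \<Rightarrow> 'v set \<Rightarrow> bool" where
  "finite_basis V B \<longleftrightarrow> finite B \<and> B \<subseteq> carrier V \<and>
     (\<forall>v\<in>carrier V. \<exists>!a. a \<in> B \<rightarrow>\<^sub>E UNIV \<and> v = lincomb V a B)"

definition coords :: "('n, 'k, 'v) graded_rep \<Rightarrow> 'v set \<Rightarrow> 'v \<Rightarrow> 'v \<Rightarrow> 'k" where
  "coords V B v = (THE a. a \<in> B \<rightarrow>\<^sub>E UNIV \<and> v = lincomb V a B)"

text \<open>
  The trace of an endomorphism of a finite-dimensional space, as the trace of its matrix in some
  basis; for linear endomorphisms the value does not depend on the basis chosen.
\<close>

definition endo_trace :: "('n, 'k::field_char_0, 'v) graded_rep \<Rightarrow> ('v \<Rightarrow> 'v) \<Rightarrow> 'k" where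
  "endo_trace V T = (let B = (SOME B. finite_basis V B) in \<Sum>b\<in>B. coords V B (T b) b)"

text \<open>
  The trace function of a finite-dimensional representation is a class function, so the
  abstraction below is the intended one on such arguments (and unspecified otherwise).
\<close>

definition rep_character ::
    "('n, 'k::field_char_0, 'v) graded_rep \<Rightarrow> ('n, 'k) class_fun" where
  "rep_character V = Abs_class_fun (\<lambda>\<sigma>. endo_trace V (gact V \<sigma>))"

definition graded_character ::
    "('n, 'k::field_char_0, 'v) graded_rep \<Rightarrow> ('n, 'k) class_fun fps" where
  "graded_character V = Abs_fps (\<lambda>d. rep_character (V\<lparr>carrier := gcomp V d\<rparr>))"


section \<open>Ideals\<close>

definition homogeneous_ideal :: "('n::finite, 'k::field_char_0) mpoly set \<Rightarrow> bool" where
  "homogeneous_ideal I \<longleftrightarrow> ideal I poly_ring \<and> (\<forall>p\<in>I. \<forall>d. homogeneous_component d p \<in> I)"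

definition perm_stable :: "('n::finite, 'k::field_char_0) mpoly set \<Rightarrow> bool" where
  "perm_stable I \<longleftrightarrow> (\<forall>\<sigma>. \<forall>p\<in>I. perm_vars \<sigma> p \<in> I)"

definition regular_sequence :: "('a, 'b) ring_scheme \<Rightarrow> 'a list \<Rightarrow> bool" where
  "regular_sequence R fs \<longleftrightarrow>
     set fs \<subseteq> carrier R \<and>
     (\<forall>i<length fs. \<forall>g\<in>carrier R.
        g \<otimes>\<^bsub>R\<^esub> fs ! i \<in> Idl\<^bsub>R\<^esub> (set (take i fs)) \<longrightarrow> g \<in> Idl\<^bsub>R\<^esub> (set (take i fs))) \<and>
     Idl\<^bsub>R\<^esub> (set fs) \<noteq> carrier R"

definition complete_intersection_ideal :: "('a, 'b) ring_scheme \<Rightarrow> 'a set \<Rightarrow> bool" where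
  "complete_intersection_ideal R I \<longleftrightarrow> (\<exists>fs. regular_sequence R fs \<and> I = Idl\<^bsub>R\<^esub> (set fs))"

definition max_ideal :: "('n::finite, 'k::field_char_0) mpoly set" where
  "max_ideal = Idl\<^bsub>poly_ring\<^esub> (range Var)"

end

theory Submission
  imports Defs
begin

text \<open>
  Averaging over the symmetric group lifts a basis of \<open>I/\<mm>I\<close> to invariant homogeneous elements
  \<open>f\<^sub>1,\<dots>,f\<^sub>m\<close> of \<open>I\<close> with \<open>f\<^sub>i\<close> of degree \<open>c\<^sub>i\<close> (\<open>invariant_lifts\<close>; this is where characteristic zero is
  needed), and by the graded Nakayama lemma they generate \<open>I\<close> (\<open>lifts_generate_homogeneous_ideal\<close>).
  If the \<open>f\<^sub>i\<close> form a regular sequence, then multiplication by \<open>f\<^bsub>k+1\<^esub>\<close> gives short exact sequences of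
  representations
  \<open>0 \<rightarrow> (R/(f\<^sub>1,\<dots>,f\<^sub>k))(-c\<^bsub>k+1\<^esub>) \<rightarrow> R/(f\<^sub>1,\<dots>,f\<^sub>k) \<rightarrow> R/(f\<^sub>1,\<dots>,f\<^bsub>k+1\<^esub>) \<rightarrow> 0\<close>,
  equivariant because \<open>f\<^bsub>k+1\<^esub>\<close> is invariant, so each new generator multiplies the graded character by
  \<open>1 - t^c\<^bsub>k+1\<^esub>\<close> (\<open>quotient_character_ideal_span_Suc\<close>).

  The point is therefore that the \<open>f\<^sub>i\<close> are regular. All that is known is that \<open>I\<close> is generated by
  some regular sequence \<open>g\<close>, whose members need not be homogeneous. Regularity is transferred through
  first syzygies, without localization. The syzygies of \<open>g\<close> are Koszul, that is, of the form \<open>S g\<close> with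
  \<open>S\<close> alternating (\<open>regular_imp_koszul_syzygy\<close>). Write \<open>f = A g\<close> and \<open>g = B f\<close>. The rows of \<open>1 - AB\<close> are
  syzygies of \<open>f\<close>, so by minimality of \<open>f\<close> their entries have no constant term. Pushing a syzygy \<open>a\<close> of
  \<open>f\<close> to \<open>g\<close> and back shows that \<open>a\<close> is a Koszul syzygy plus \<open>a (1 - AB)\<close>, which is again a syzygy and
  vanishes to higher order at the origin. Iterating, \<open>a\<close> is Koszul modulo every power of \<open>\<mm>\<close>, and
  for homogeneous \<open>a\<close> comparing the terms of a single degree removes the error
  (\<open>minimal_generators_syzygies_koszul\<close>). Finally, if all homogeneous syzygies of \<open>f\<^sub>1,\<dots>,f\<^bsub>k+1\<^esub>\<close> are Koszul,
  so are those of \<open>f\<^sub>1,\<dots>,f\<^sub>k\<close>, by induction on the degree (\<open>homogeneous_syzygies_koszul_descend\<close>), and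
  Koszul syzygies make \<open>f\<^bsub>k+1\<^esub>\<close> a nonzerodivisor modulo \<open>(f\<^sub>1,\<dots>,f\<^sub>k)\<close>.

  On the character side, everything happens inside the finite-dimensional spaces \<open>R\<^sub>d\<close> of homogeneous
  polynomials. Traces on quotients \<open>U/W\<close> of subspaces are computed there from vectors of \<open>U\<close> and coordinate
  functionals that vanish on \<open>W\<close>. Such traces are additive in towers \<open>W \<subseteq> V \<subseteq> U\<close> and invariant under
  equivariant isomorphisms of quotients, and \<open>endo_trace_eq_quotient_trace\<close> identifies them with the
  traces in the definition of the graded character.
\<close>


section \<open>Traces on quotients of subspaces\<close>

text \<open>
  A locale of its own keeps the notions below from being carried over to the existing global
  interpretations of \<open>vector_space\<close>, such as the real vector spaces.
\<close>
locale linear_space = vector_space scale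
  for scale :: "'a::field \<Rightarrow> 'b::ab_group_add \<Rightarrow> 'b"
begin

text \<open>
  A basis of \<open>U/W\<close>, given by representatives \<open>e j \<in> U\<close> together with the coordinate functionals
  \<open>\<kappa> j\<close>. Carrying the functionals along makes every statement about traces an
  identity between finite sums, and no quotient space has to be formed.
\<close>
definition quotient_frame ::
    "'b set \<Rightarrow> 'b set \<Rightarrow> 'i set \<Rightarrow> ('i \<Rightarrow> 'b) \<Rightarrow> ('i \<Rightarrow> 'b \<Rightarrow> 'a) \<Rightarrow> bool" where
  "quotient_frame U W J e \<kappa> \<longleftrightarrow> finite J \<and> e ` J \<subseteq> U \<and>
     (\<forall>j\<in>J. \<forall>x\<in>U. \<forall>y\<in>U. \<kappa> j (x + y) = \<kappa> j x + \<kappa> j y) \<and>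
     (\<forall>j\<in>J. \<forall>a. \<forall>x\<in>U. \<kappa> j (scale a x) = a * \<kappa> j x) \<and>
     (\<forall>j\<in>J. \<forall>x\<in>W. \<kappa> j x = 0) \<and>
     (\<forall>i\<in>J. \<forall>j\<in>J. \<kappa> i (e j) = (if i = j then 1 else 0)) \<and>
     (\<forall>x\<in>U. x - (\<Sum>j\<in>J. scale (\<kappa> j x) (e j)) \<in> W)"

lemma quotient_frameD:
  assumes "quotient_frame U W J e \<kappa>"
  shows "finite J" "\<And>j. j \<in> J \<Longrightarrow> e j \<in> U"
    "\<And>j x y. j \<in> J \<Longrightarrow> x \<in> U \<Longrightarrow> y \<in> U \<Longrightarrow> \<kappa> j (x + y) = \<kappa> j x + \<kappa> j y"
    "\<And>j a x. j \<in> J \<Longrightarrow> x \<in> U \<Longrightarrow> \<kappa> j (scale a x) = a * \<kappa> j x"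
    "\<And>j x. j \<in> J \<Longrightarrow> x \<in> W \<Longrightarrow> \<kappa> j x = 0"
    "\<And>i j. i \<in> J \<Longrightarrow> j \<in> J \<Longrightarrow> \<kappa> i (e j) = (if i = j then 1 else 0)"
    "\<And>x. x \<in> U \<Longrightarrow> x - (\<Sum>j\<in>J. scale (\<kappa> j x) (e j)) \<in> W"
  using assms unfolding quotient_frame_def by auto

lemma quotient_frame_coord_sum:
  assumes "quotient_frame U W J e \<kappa>" "subspace U" "i \<in> J" "finite A" "\<And>j. j \<in> A \<Longrightarrow> x j \<in> U"
  shows "\<kappa> i (\<Sum>j\<in>A. scale (a j) (x j)) = (\<Sum>j\<in>A. a j * \<kappa> i (x j))"
  using assms(4,5)
proof (induction rule: finite_induct)
  case empty
  have "\<kappa> i (scale 0 0) = 0 * \<kappa> i 0"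
    using quotient_frameD(4)[OF assms(1,3)] subspace_0[OF assms(2)] by blast
  then show ?case by simp
next
  case (insert j A)
  have "(\<Sum>j\<in>A. scale (a j) (x j)) \<in> U" "scale (a j) (x j) \<in> U"
    using insert by (auto intro!: subspace_sum[OF assms(2)] subspace_scale[OF assms(2)])
  then show ?case
    using insert quotient_frameD(3,4)[OF assms(1,3)] by simp
qed

lemma quotient_frame_coord_diff:
  assumes "quotient_frame U W J e \<kappa>" "subspace U" "i \<in> J" "x \<in> U" "y \<in> U"
  shows "\<kappa> i (x - y) = \<kappa> i x - \<kappa> i y"
proof -
  have "\<kappa> i (x - y + y) = \<kappa> i (x - y) + \<kappa> i y"
    using quotient_frameD(3)[OF assms(1,3), of "x - y" y] assms by (simp add: subspace_diff)
  then show ?thesis by simp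
qed

text \<open>
  The usual proof that the trace does not depend on the basis: both sides expand to the trace of
  the product of the two base change matrices with the mixed matrix of \<open>T\<close>.
\<close>
lemma quotient_frame_trace_unique:
  assumes F: "quotient_frame U W J e \<kappa>" and F': "quotient_frame U W J' e' \<kappa>'"
    and U: "subspace U" and WU: "W \<subseteq> U"
    and T: "Vector_Spaces.linear scale scale T" and TU: "T ` U \<subseteq> U" and TW: "T ` W \<subseteq> W"
  shows "(\<Sum>j\<in>J. \<kappa> j (T (e j))) = (\<Sum>j\<in>J'. \<kappa>' j (T (e' j)))"
proof -
  interpret T: Vector_Spaces.linear scale scale T by (fact T)
  \<comment> \<open>each trace is the double sum of the entries of the two base change matrices around \<open>T\<close>\<close>
  have *: "\<kappa>1 i (T (e1 i)) = (\<Sum>j\<in>J2. \<kappa>2 j (e1 i) * \<kappa>1 i (T (e2 j)))"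
    if F1: "quotient_frame U W J1 e1 \<kappa>1" and F2: "quotient_frame U W J2 e2 \<kappa>2" and i: "i \<in> J1"
    for J1 :: "'x set" and e1 \<kappa>1 and J2 :: "'y set" and e2 \<kappa>2 i
  proof -
    note d1 = quotient_frameD[OF F1] and d2 = quotient_frameD[OF F2]
    define s where "s = (\<Sum>j\<in>J2. scale (\<kappa>2 j (e1 i)) (e2 j))"
    have sU: "s \<in> U" unfolding s_def using U d2 by (auto intro!: subspace_sum subspace_scale)
    have e: "e1 i \<in> U" using d1 i by auto
    have "T (e1 i - s) \<in> W" using d2(7)[OF e] TW unfolding s_def by auto
    then have "0 = \<kappa>1 i (T (e1 i) - T s)" using d1(5)[OF i] by (metis T.diff)
    also have "\<dots> = \<kappa>1 i (T (e1 i)) - \<kappa>1 i (T s)"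
      using quotient_frame_coord_diff[OF F1 U i] TU e sU by blast
    finally have "\<kappa>1 i (T (e1 i)) = \<kappa>1 i (T s)" by simp
    also have "T s = (\<Sum>j\<in>J2. scale (\<kappa>2 j (e1 i)) (T (e2 j)))"
      unfolding s_def by (simp add: T.sum T.scale)
    also have "\<kappa>1 i \<dots> = (\<Sum>j\<in>J2. \<kappa>2 j (e1 i) * \<kappa>1 i (T (e2 j)))"
      by (rule quotient_frame_coord_sum[OF F1 U i d2(1)]) (use d2(2) TU in auto)
    finally show ?thesis .
  qed
  have **: "\<kappa>2 j (T (e2 j)) = (\<Sum>i\<in>J1. \<kappa>2 j (e1 i) * \<kappa>1 i (T (e2 j)))"
    if F1: "quotient_frame U W J1 e1 \<kappa>1" and F2: "quotient_frame U W J2 e2 \<kappa>2" and j: "j \<in> J2"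
    for J1 :: "'x set" and e1 \<kappa>1 and J2 :: "'y set" and e2 \<kappa>2 j
  proof -
    note d1 = quotient_frameD[OF F1] and d2 = quotient_frameD[OF F2]
    let ?v = "T (e2 j)"
    have v: "?v \<in> U" using d2 j TU by auto
    define s where "s = (\<Sum>i\<in>J1. scale (\<kappa>1 i ?v) (e1 i))"
    have sU: "s \<in> U" unfolding s_def using U d1 by (auto intro!: subspace_sum subspace_scale)
    have "0 = \<kappa>2 j (?v - s)" using d2(5)[OF j d1(7)[OF v]] unfolding s_def by (rule sym)
    also have "\<dots> = \<kappa>2 j ?v - \<kappa>2 j s"
      using quotient_frame_coord_diff[OF F2 U j v sU] .
    finally have "\<kappa>2 j ?v = \<kappa>2 j s" by simp
    also have "\<dots> = (\<Sum>i\<in>J1. \<kappa>1 i ?v * \<kappa>2 j (e1 i))"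
      unfolding s_def by (rule quotient_frame_coord_sum[OF F2 U j d1(1) d1(2)])
    finally show ?thesis by (simp add: mult.commute)
  qed
  have "(\<Sum>j\<in>J. \<kappa> j (T (e j))) = (\<Sum>i\<in>J. \<Sum>j\<in>J'. \<kappa>' j (e i) * \<kappa> i (T (e' j)))"
    by (rule sum.cong[OF refl *[OF F F']])
  also have "\<dots> = (\<Sum>j\<in>J'. \<Sum>i\<in>J. \<kappa>' j (e i) * \<kappa> i (T (e' j)))"
    by (rule sum.swap)
  also have "\<dots> = (\<Sum>j\<in>J'. \<kappa>' j (T (e' j)))"
    by (rule sum.cong[OF refl **[OF F F', symmetric]])
  finally show ?thesis .
qed

definition quotient_trace :: "'b set \<Rightarrow> 'b set \<Rightarrow> ('b \<Rightarrow> 'b) \<Rightarrow> 'a" where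
  "quotient_trace U W T =
     (SOME t. \<exists>C \<kappa>. quotient_frame U W C (\<lambda>x. x) \<kappa> \<and> t = (\<Sum>c\<in>C. \<kappa> c (T c)))"

lemma quotient_frame_reindex:
  assumes F: "quotient_frame U W J e \<kappa>"
  shows "quotient_frame U W (e ` J) (\<lambda>x. x) (\<lambda>c. \<kappa> (inv_into J e c))"
proof -
  note d = quotient_frameD[OF F]
  have inj: "inj_on e J" using d(6) by (metis inj_onI zero_neq_one)
  have "(\<Sum>c\<in>e ` J. scale (\<kappa> (inv_into J e c) x) c) = (\<Sum>j\<in>J. scale (\<kappa> j x) (e j))" for x
    by (simp add: sum.reindex[OF inj] inv_into_f_f[OF inj])
  note sum = this
  let ?i = "inv_into J e"
  have i: "?i c \<in> J" "e (?i c) = c" if "c \<in> e ` J" for c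
    using that by (auto intro: inv_into_into f_inv_into_f)
  show ?thesis
    unfolding quotient_frame_def
  proof (intro conjI ballI allI)
    fix b c assume "b \<in> e ` J" "c \<in> e ` J"
    then show "\<kappa> (?i b) c = (if b = c then 1 else 0)"
      using d(6)[of "?i b" "?i c"] i by metis
  next
    fix x assume "x \<in> U"
    then show "x - (\<Sum>c\<in>e ` J. scale (\<kappa> (?i c) x) c) \<in> W"
      using d(7) by (simp only: sum)
  next
    show "(\<lambda>x. x) ` e ` J \<subseteq> U" using d(2) by blast
  qed (use d(1) d(3-5)[OF i(1)] in simp_all)
qed

lemma quotient_trace_frame:
  assumes F: "quotient_frame U W J e \<kappa>"
    and "subspace U" "W \<subseteq> U" "Vector_Spaces.linear scale scale T" "T ` U \<subseteq> U" "T ` W \<subseteq> W"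
  shows "quotient_trace U W T = (\<Sum>j\<in>J. \<kappa> j (T (e j)))"
  unfolding quotient_trace_def
proof (rule some_equality)
  let ?C = "e ` J" and ?\<kappa> = "\<lambda>c. \<kappa> (inv_into J e c)"
  have "quotient_frame U W ?C (\<lambda>x. x) ?\<kappa>" by (rule quotient_frame_reindex[OF F])
  moreover from this have "(\<Sum>j\<in>J. \<kappa> j (T (e j))) = (\<Sum>c\<in>?C. ?\<kappa> c (T c))"
    by (rule quotient_frame_trace_unique[OF F _ assms(2-6)])
  ultimately show "\<exists>C \<kappa>'. quotient_frame U W C (\<lambda>x. x) \<kappa>' \<and> (\<Sum>j\<in>J. \<kappa> j (T (e j))) = (\<Sum>c\<in>C. \<kappa>' c (T c))"
    by (rule exI[of _ ?C, OF exI[of _ ?\<kappa>, OF conjI]])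
next
  fix t assume "\<exists>C \<kappa>. quotient_frame U W C (\<lambda>x. x) \<kappa> \<and> t = (\<Sum>c\<in>C. \<kappa> c (T c))"
  then obtain C \<kappa>' where F': "quotient_frame U W C (\<lambda>x. x) \<kappa>'" and t: "t = (\<Sum>c\<in>C. \<kappa>' c (T c))"
    by (elim exE conjE)
  show "t = (\<Sum>j\<in>J. \<kappa> j (T (e j)))"
    unfolding t by (rule quotient_frame_trace_unique[OF F' F assms(2-6)])
qed

text \<open>
  Extend a basis \<open>B0\<close> of \<open>W\<close> to a basis \<open>B\<close> of \<open>U\<close>: the new vectors \<open>B - B0\<close>, with their coordinates
  relative to \<open>B\<close>, form a frame.
\<close>
lemma quotient_frame_exists:
  assumes U: "subspace U" and W: "subspace W" and WU: "W \<subseteq> U" and S: "finite S" "U \<subseteq> span S"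
  shows "\<exists>C \<kappa>. quotient_frame U W C (\<lambda>x. x) \<kappa>"
proof -
  obtain B0 where B0: "B0 \<subseteq> W" "independent B0" "W \<subseteq> span B0"
    using maximal_independent_subset[of W] by auto
  have "B0 \<subseteq> U" using B0 WU by auto
  then obtain B where B: "B0 \<subseteq> B" "B \<subseteq> U" "independent B" "U \<subseteq> span B"
    using maximal_independent_subset_extend[of B0 U] B0(2) by blast
  have finB: "finite B" using independent_span_bound[OF S(1) B(3)] B(2) S(2) by auto
  have "quotient_frame U W (B - B0) (\<lambda>x. x) (\<lambda>c x. representation B x c)"
    unfolding quotient_frame_def
  proof (intro conjI ballI allI)
    fix j x assume "j \<in> B - B0" "x \<in> W"
    then have "x \<in> span B0" using B0 by auto
    then have "representation B x = representation B0 x"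
      using representation_extend[OF B(3)] B(1) by blast
    then show "representation B x j = 0"
      using \<open>j \<in> B - B0\<close> representation_ne_zero by auto
  next
    fix x assume x: "x \<in> U"
    then have "x = (\<Sum>b\<in>B. scale (representation B x b) b)"
      using sum_representation_eq[OF B(3) _ finB] B(4) by auto
    also have "\<dots> = (\<Sum>b\<in>B - B0. scale (representation B x b) b) + (\<Sum>b\<in>B0. scale (representation B x b) b)"
      using finB B(1) by (metis sum.subset_diff)
    finally have "x - (\<Sum>b\<in>B - B0. scale (representation B x b) b) = (\<Sum>b\<in>B0. scale (representation B x b) b)"
      by (metis add_diff_cancel_left')
    also have "\<dots> \<in> W" using B0(1) W by (auto intro!: subspace_sum subspace_scale)
    finally show "x - (\<Sum>j\<in>B - B0. scale (representation B x j) j) \<in> W" .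
  next
    fix i j assume "i \<in> B - B0" "j \<in> B - B0"
    then show "representation B j i = (if i = j then 1 else 0)"
      using representation_basis[OF B(3)] by auto
  next
    fix j x y assume "j \<in> B - B0" "x \<in> U" "y \<in> U"
    then have "x \<in> span B" "y \<in> span B" using B(4) by auto
    then show "representation B (x + y) j = representation B x j + representation B y j"
      by (simp add: representation_add[OF B(3)])
  next
    fix j a x assume "j \<in> B - B0" "x \<in> U"
    then have "x \<in> span B" using B(4) by auto
    then show "representation B (scale a x) j = a * representation B x j"
      by (simp add: representation_scale[OF B(3)])
  qed (use finB B in auto)
  then show ?thesis by blast
qed

text \<open>
  The union of frames of \<open>U/V\<close> and \<open>V/W\<close> is a frame of \<open>U/W\<close>. A functional of the second frame is
  defined only on \<open>V\<close>; it is extended to \<open>U\<close> by first subtracting the part seen by the first frame.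
\<close>
lemma quotient_trace_tower:
  assumes "subspace U" "subspace V" "subspace W" "W \<subseteq> V" "V \<subseteq> U" "finite S" "U \<subseteq> span S"
    and T: "Vector_Spaces.linear scale scale T" "T ` U \<subseteq> U" "T ` V \<subseteq> V" "T ` W \<subseteq> W"
  shows "quotient_trace U W T = quotient_trace U V T + quotient_trace V W T"
proof -
  obtain C1 \<kappa>1 where F1: "quotient_frame U V C1 (\<lambda>x. x) \<kappa>1"
    using quotient_frame_exists[OF assms(1,2,5-7)] by blast
  have "V \<subseteq> span S" using assms by blast
  then obtain C2 \<kappa>2 where F2: "quotient_frame V W C2 (\<lambda>x. x) \<kappa>2"
    using quotient_frame_exists[OF assms(2-4,6)] by blast
  note d1 = quotient_frameD[OF F1] and d2 = quotient_frameD[OF F2]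
  define r where "r x = x - (\<Sum>c\<in>C1. scale (\<kappa>1 c x) c)" for x
  have rV: "r x \<in> V" if "x \<in> U" for x using d1(7) that unfolding r_def by auto
  have radd: "r (x + y) = r x + r y" if "x \<in> U" "y \<in> U" for x y
    unfolding r_def using that d1(3) by (simp add: scale_left_distrib sum.distrib)
  have rscale: "r (scale a x) = scale a (r x)" if "x \<in> U" for a x
    unfolding r_def using that d1(4) by (simp add: scale_right_diff_distrib scale_sum_right)
  have rid: "r x = x" if "x \<in> V" for x
    unfolding r_def using that d1(5) by simp
  have r0: "r c = 0" if "c \<in> C1" for c
  proof -
    have "(\<Sum>c'\<in>C1. scale (\<kappa>1 c' c) c') = (\<Sum>c'\<in>C1. if c' = c then c else 0)"
      using d1(6) that by (intro sum.cong) auto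
    also have "\<dots> = c" using that d1(1) by simp
    finally show ?thesis unfolding r_def by simp
  qed
  define \<kappa> where "\<kappa> c x = (if c \<in> C1 then \<kappa>1 c x else \<kappa>2 c (r x))" for c x
  have disj: "C1 \<inter> C2 = {}" using d1(5,6) d2(2) by (metis disjoint_iff zero_neq_one)
  have fin: "finite C1" "finite C2" using d1 d2 by auto
  have V0: "0 \<in> V" using \<open>subspace V\<close> subspace_0 by blast
  have k20: "\<kappa>2 j 0 = 0" if "j \<in> C2" for j
    using d2(5)[OF that] \<open>subspace W\<close> subspace_0 by blast
  have notC1: "c \<notin> C1" if "c \<in> C2" for c using disj that by auto
  have "quotient_frame U W (C1 \<union> C2) (\<lambda>x. x) \<kappa>"
    unfolding quotient_frame_def
  proof (intro conjI ballI allI)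
    fix x assume x: "x \<in> U"
    have "(\<Sum>j\<in>C1 \<union> C2. scale (\<kappa> j x) j) = (\<Sum>j\<in>C1. scale (\<kappa> j x) j) + (\<Sum>j\<in>C2. scale (\<kappa> j x) j)"
      using sum.union_disjoint[OF fin disj] .
    also have "(\<Sum>j\<in>C1. scale (\<kappa> j x) j) = x - r x" unfolding r_def \<kappa>_def by simp
    also have "(\<Sum>j\<in>C2. scale (\<kappa> j x) j) = (\<Sum>j\<in>C2. scale (\<kappa>2 j (r x)) j)"
      unfolding \<kappa>_def by (rule sum.cong) (auto simp: notC1)
    finally show "x - (\<Sum>j\<in>C1 \<union> C2. scale (\<kappa> j x) j) \<in> W"
      using d2(7)[OF rV[OF x]] by (simp only: diff_add_eq_diff_diff_swap diff_diff_eq2) simp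
  next
    fix i j assume "i \<in> C1 \<union> C2" "j \<in> C1 \<union> C2"
    then show "\<kappa> i j = (if i = j then 1 else 0)"
      using notC1 d1(5,6) d2(2,6) r0 rid k20 unfolding \<kappa>_def by auto
  next
    show "(\<lambda>x. x) ` (C1 \<union> C2) \<subseteq> U" using d1(2) d2(2) \<open>V \<subseteq> U\<close> by auto
  next
    fix j x assume "j \<in> C1 \<union> C2" "x \<in> W"
    then show "\<kappa> j x = 0" using d1(5) d2(5) rid \<open>W \<subseteq> V\<close> unfolding \<kappa>_def by auto
  qed (use fin radd rscale rV d1(3,4) d2(3,4) in \<open>auto simp: \<kappa>_def\<close>)
  from quotient_trace_frame[OF this \<open>subspace U\<close> _ T(1,2,4)] assms
  have "quotient_trace U W T = (\<Sum>j\<in>C1 \<union> C2. \<kappa> j (T j))" by auto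
  also have "\<dots> = (\<Sum>j\<in>C1. \<kappa> j (T j)) + (\<Sum>j\<in>C2. \<kappa> j (T j))"
    using sum.union_disjoint[OF fin disj] .
  also have "(\<Sum>j\<in>C1. \<kappa> j (T j)) = quotient_trace U V T"
    using quotient_trace_frame[OF F1 \<open>subspace U\<close> _ T(1,2,3)] assms by (simp add: \<kappa>_def)
  also have "(\<Sum>j\<in>C2. \<kappa> j (T j)) = (\<Sum>j\<in>C2. \<kappa>2 j (T j))"
  proof (rule sum.cong)
    fix c assume c: "c \<in> C2"
    then have "T c \<in> V" using d2(2) T(3) by blast
    then show "\<kappa> c (T c) = \<kappa>2 c (T c)" using notC1[OF c] rid by (simp add: \<kappa>_def)
  qed simp
  also have "\<dots> = quotient_trace V W T"
    using quotient_trace_frame[OF F2 \<open>subspace V\<close> _ T(1,3,4)] assms by simp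
  finally show ?thesis .
qed

text \<open>
  The hypotheses say that \<open>h\<close> induces an isomorphism \<open>U/W \<rightarrow> U'/W'\<close> intertwining \<open>T\<close> and \<open>T'\<close>. Used
  with \<open>h\<close> a permutation of the variables it shows that characters are class functions, and with
  \<open>h\<close> multiplication by a generator it gives the exact sequence of quotients of the polynomial ring.
\<close>
lemma quotient_trace_transport:
  assumes U: "subspace U" and W: "subspace W" and WU: "W \<subseteq> U" and S: "finite S" "U \<subseteq> span S"
    and U': "subspace U'" and W': "subspace W'" and WU': "W' \<subseteq> U'"
    and T: "Vector_Spaces.linear scale scale T" "T ` U \<subseteq> U" "T ` W \<subseteq> W"
    and T': "Vector_Spaces.linear scale scale T'" "T' ` U' \<subseteq> U'" "T' ` W' \<subseteq> W'"
    and h: "Vector_Spaces.linear scale scale h" "h ` U \<subseteq> U'"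
    and onto: "\<And>y. y \<in> U' \<Longrightarrow> \<exists>x\<in>U. y - h x \<in> W'"
    and ker: "\<And>x. x \<in> U \<Longrightarrow> h x \<in> W' \<longleftrightarrow> x \<in> W"
    and comm: "\<And>x. x \<in> U \<Longrightarrow> T' (h x) = h (T x)"
  shows "quotient_trace U' W' T' = quotient_trace U W T"
proof -
  interpret h: Vector_Spaces.linear scale scale h by (fact h)
  obtain C \<kappa> where F: "quotient_frame U W C (\<lambda>x. x) \<kappa>"
    using quotient_frame_exists[OF U W WU S] by auto
  note d = quotient_frameD[OF F]
  \<comment> \<open>\<open>g\<close> inverts the induced map \<open>U/W \<rightarrow> U'/W'\<close> on representatives; by \<open>kg\<close> the choice is invisible to \<open>\<kappa>\<close>\<close>
  define g where "g y = (SOME x. x \<in> U \<and> y - h x \<in> W')" for y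
  have g: "g y \<in> U" "y - h (g y) \<in> W'" if "y \<in> U'" for y
    using someI_ex[of "\<lambda>x. x \<in> U \<and> y - h x \<in> W'"] onto[OF that] unfolding g_def by auto
  have kg: "\<kappa> c (g y) = \<kappa> c x" if "c \<in> C" "y \<in> U'" "x \<in> U" "y - h x \<in> W'" for c x y
  proof -
    have "(y - h x) - (y - h (g y)) \<in> W'"
      using subspace_diff[OF W' that(4) g(2)[OF that(2)]] .
    then have "h (g y - x) \<in> W'" by (simp add: h.diff)
    moreover have gx: "g y - x \<in> U" using subspace_diff[OF U g(1)] that by blast
    ultimately have "g y - x \<in> W" using ker by auto
    then have "\<kappa> c (g y - x) = 0" using d(5) that by auto
    then show ?thesis using quotient_frame_coord_diff[OF F U \<open>c \<in> C\<close> g(1) that(3)] that by auto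
  qed
  have F': "quotient_frame U' W' C h (\<lambda>c y. \<kappa> c (g y))"
    unfolding quotient_frame_def
  proof (intro conjI ballI allI)
    fix j x y assume j: "j \<in> C" and xy: "x \<in> U'" "y \<in> U'"
    have "x + y - h (g x + g y) = (x - h (g x)) + (y - h (g y))" by (simp add: h.add)
    then have "x + y - h (g x + g y) \<in> W'" using subspace_add[OF W' g(2)[OF xy(1)] g(2)[OF xy(2)]] by metis
    then have "\<kappa> j (g (x + y)) = \<kappa> j (g x + g y)"
      using kg[OF j subspace_add[OF U' xy] subspace_add[OF U g(1) g(1)]] xy by blast
    then show "\<kappa> j (g (x + y)) = \<kappa> j (g x) + \<kappa> j (g y)" using d(3) j g(1) xy by auto
  next
    fix j a x assume j: "j \<in> C" and x: "x \<in> U'"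
    have "scale a x - h (scale a (g x)) = scale a (x - h (g x))"
      by (simp add: h.scale scale_right_diff_distrib)
    then have "scale a x - h (scale a (g x)) \<in> W'" using subspace_scale[OF W' g(2)[OF x]] by simp
    then have "\<kappa> j (g (scale a x)) = \<kappa> j (scale a (g x))"
      using kg[OF j subspace_scale[OF U' x] subspace_scale[OF U g(1)[OF x]]] by blast
    then show "\<kappa> j (g (scale a x)) = a * \<kappa> j (g x)" using d(4) j g(1) x by auto
  next
    fix j x assume j: "j \<in> C" and x: "x \<in> W'"
    have "\<kappa> j (g x) = \<kappa> j 0"
      using kg[OF j, of x 0] x WU' subspace_0[OF U] by (auto simp: h.zero)
    then show "\<kappa> j (g x) = 0" using d(5)[OF j] subspace_0[OF W] by auto
  next
    fix i j assume ij: "i \<in> C" "j \<in> C"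
    have "\<kappa> i (g (h j)) = \<kappa> i j"
      using kg[OF ij(1), of "h j" j] d(2)[OF ij(2)] h(2) subspace_0[OF W'] by auto
    then show "\<kappa> i (g (h j)) = (if i = j then 1 else 0)" using d(6) ij by auto
  next
    fix y assume y: "y \<in> U'"
    let ?s = "\<Sum>c\<in>C. scale (\<kappa> c (g y)) c"
    have "?s \<in> U" using U d(2) by (auto intro!: subspace_sum subspace_scale)
    then have "h (g y - ?s) \<in> W'" using d(7)[OF g(1)[OF y]] ker g(1)[OF y] U WU by auto
    then have "(y - h (g y)) + h (g y - ?s) \<in> W'" using g(2)[OF y] W' subspace_add by blast
    then show "y - (\<Sum>c\<in>C. scale (\<kappa> c (g y)) (h c)) \<in> W'"
      by (simp add: h.diff h.sum h.scale)
  qed (use d h(2) in auto)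
  have "quotient_trace U' W' T' = (\<Sum>c\<in>C. \<kappa> c (g (T' (h c))))"
    using quotient_trace_frame[OF F' U' WU' T'] .
  also have "\<dots> = (\<Sum>c\<in>C. \<kappa> c (T c))"
  proof (rule sum.cong)
    fix c assume c: "c \<in> C"
    then have "c \<in> U" using d by auto
    then have Tc: "T c \<in> U" "h (T c) \<in> U'" using T(2) h(2) by auto
    show "\<kappa> c (g (T' (h c))) = \<kappa> c (T c)"
      using kg[OF c Tc(2) Tc(1)] subspace_0[OF W'] comm[OF \<open>c \<in> U\<close>] by simp
  qed simp
  also have "\<dots> = quotient_trace U W T" using quotient_trace_frame[OF F U WU T] by simp
  finally show ?thesis .
qed

end

section \<open>Homogeneous components and the action of the symmetric group\<close>

lemma lookup_Const_mult [simp]: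
  "Poly_Mapping.lookup (Const c * p) a = c * Poly_Mapping.lookup p a"
  unfolding Const_def mult_map_scale_conv_mult[symmetric]
  by (simp add: Poly_Mapping.map.rep_eq when_def)

lemma Const_0 [simp]: "Const 0 = 0"
  and Const_1 [simp]: "Const 1 = 1"
  and Const_add: "Const (c + d) = Const c + Const d"
  and Const_mult: "Const (c * d) = Const c * Const d"
  by (simp_all add: Const_def single_add mult_single)

interpretation mpoly: linear_space "\<lambda>c p :: ('n::finite, 'k::field_char_0) mpoly. Const c * p"
  by unfold_locales (simp_all add: Const_add Const_mult algebra_simps)

lemma mpoly_sum_monomials:
  "p = (\<Sum>a\<in>Poly_Mapping.keys p. Poly_Mapping.single a (Poly_Mapping.lookup p a))"
proof (rule poly_mapping_eqI)
  fix b
  show "Poly_Mapping.lookup p b = Poly_Mapping.lookup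
      (\<Sum>a\<in>Poly_Mapping.keys p. Poly_Mapping.single a (Poly_Mapping.lookup p a)) b"
    by (simp add: lookup_sum lookup_single when_def in_keys_iff)
qed

lemma mpoly_additive_induct [case_names single add]:
  assumes "\<And>a u. P (Poly_Mapping.single a u)" and "\<And>p q. P p \<Longrightarrow> P q \<Longrightarrow> P (p + q)"
  shows "P (p :: 'a \<Rightarrow>\<^sub>0 'b::comm_monoid_add)"
proof -
  have "P (\<Sum>a\<in>A. Poly_Mapping.single a (Poly_Mapping.lookup p a))" if "finite A" for A
    using that
  proof (induction rule: finite_induct)
    case empty
    show ?case using assms(1)[of undefined 0] by simp
  qed (simp add: assms)
  then show ?thesis
    using mpoly_sum_monomials[of p] finite_keys by metis
qed

lemma mon_degree_add [simp]: "mon_degree (a + b) = mon_degree a + mon_degree b"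
  by (simp add: mon_degree_def lookup_add sum.distrib)

lemma mon_degree_0 [simp]: "mon_degree 0 = 0"
  by (simp add: mon_degree_def)

lemma mon_degree_single [simp]: "mon_degree (Poly_Mapping.single i k) = k"
  by (simp add: mon_degree_def lookup_single when_def)

lemma homogeneous_polys_iff:
  "p \<in> homogeneous_polys d \<longleftrightarrow> (\<forall>a. Poly_Mapping.lookup p a \<noteq> 0 \<longrightarrow> mon_degree a = d)"
  by (auto simp: homogeneous_polys_def in_keys_iff)

lemma subspace_homogeneous_polys:
  "mpoly.subspace (homogeneous_polys d :: ('n::finite, 'k::field_char_0) mpoly set)"
proof (rule mpoly.subspaceI)
  fix p q :: "('n, 'k) mpoly" assume "p \<in> homogeneous_polys d" "q \<in> homogeneous_polys d"
  then show "p + q \<in> homogeneous_polys d"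
    using keys_add[of p q] unfolding homogeneous_polys_def by blast
qed (simp_all add: homogeneous_polys_iff)

lemma homogeneous_polys_mult:
  assumes "p \<in> homogeneous_polys d" and "q \<in> homogeneous_polys e"
  shows "p * q \<in> homogeneous_polys (d + e)"
  unfolding homogeneous_polys_def
proof (intro CollectI ballI)
  fix a assume "a \<in> Poly_Mapping.keys (p * q)"
  then obtain b c where "a = b + c" "b \<in> Poly_Mapping.keys p" "c \<in> Poly_Mapping.keys q"
    using keys_mult[of p q] by blast
  then show "mon_degree a = d + e"
    using assms by (simp add: homogeneous_polys_def)
qed

lemma finite_monomials_of_degree: "finite {a :: 'n::finite \<Rightarrow>\<^sub>0 nat. mon_degree a = d}"
proof (rule finite_imageD)
  have "Poly_Mapping.lookup a i \<le> mon_degree a" for a :: "'n \<Rightarrow>\<^sub>0 nat" and i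
    unfolding mon_degree_def by (rule member_le_sum) auto
  then have "Poly_Mapping.lookup ` {a :: 'n \<Rightarrow>\<^sub>0 nat. mon_degree a = d} \<subseteq> (\<Pi>\<^sub>E i\<in>UNIV. {..d})"
    by (metis (mono_tags, lifting) PiE_UNIV_domain Pi_I atMost_iff image_subsetI mem_Collect_eq)
  then show "finite (Poly_Mapping.lookup ` {a :: 'n \<Rightarrow>\<^sub>0 nat. mon_degree a = d})"
    by (rule finite_subset) (rule finite_PiE; simp)
  show "inj_on Poly_Mapping.lookup {a :: 'n \<Rightarrow>\<^sub>0 nat. mon_degree a = d}"
    by (rule inj_onI) (rule poly_mapping_eqI, simp)
qed

lemma homogeneous_polys_finitely_spanned:
  "\<exists>S. finite S \<and> (homogeneous_polys d :: ('n::finite, 'k::field_char_0) mpoly set) \<subseteq> mpoly.span S"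
proof -
  let ?S = "(\<lambda>a. Poly_Mapping.single a (1::'k)) ` {a :: 'n \<Rightarrow>\<^sub>0 nat. mon_degree a = d}"
  have "p \<in> mpoly.span ?S" if p: "p \<in> homogeneous_polys d" for p
  proof -
    have "p = (\<Sum>a\<in>Poly_Mapping.keys p. Const (Poly_Mapping.lookup p a) * Poly_Mapping.single a 1)"
      by (subst mpoly_sum_monomials) (simp add: Const_def mult_single)
    also have "\<dots> \<in> mpoly.span ?S"
      using p by (intro mpoly.span_sum mpoly.span_scale mpoly.span_base imageI) (simp add: homogeneous_polys_def)
    finally show ?thesis .
  qed
  then show ?thesis using finite_monomials_of_degree by blast
qed

lemma lookup_homogeneous_component:
  "Poly_Mapping.lookup (homogeneous_component d p) a = (if mon_degree a = d then Poly_Mapping.lookup p a else 0)"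
  by (auto simp: homogeneous_component_def lookup_sum lookup_single when_def in_keys_iff)

lemma homogeneous_component_add:
  "homogeneous_component d (p + q) = homogeneous_component d p + homogeneous_component d q"
  by (rule poly_mapping_eqI) (simp add: lookup_homogeneous_component lookup_add)

lemma homogeneous_component_0 [simp]: "homogeneous_component d 0 = 0"
  by (rule poly_mapping_eqI) (simp add: lookup_homogeneous_component)

lemma homogeneous_component_uminus:
  "homogeneous_component d (- p) = - homogeneous_component d p"
  by (rule poly_mapping_eqI) (simp add: lookup_homogeneous_component)

lemma homogeneous_component_sum:
  "homogeneous_component d (\<Sum>i\<in>A. f i) = (\<Sum>i\<in>A. homogeneous_component d (f i))"
  by (induction A rule: infinite_finite_induct) (auto simp: homogeneous_component_add)

lemma homogeneous_component_in: "homogeneous_component d p \<in> homogeneous_polys d"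
  by (auto simp: homogeneous_polys_iff lookup_homogeneous_component)

lemma homogeneous_component_homogeneous:
  assumes "p \<in> homogeneous_polys d"
  shows "homogeneous_component e p = (if e = d then p else 0)"
  using assms
  by (intro poly_mapping_eqI) (auto simp: lookup_homogeneous_component homogeneous_polys_iff)

lemma homogeneous_component_single:
  "homogeneous_component d (Poly_Mapping.single a u) =
     (if mon_degree a = d then Poly_Mapping.single a u else 0)"
  by (rule poly_mapping_eqI) (auto simp: lookup_homogeneous_component lookup_single when_def)

lemma homogeneous_component_mult:
  "homogeneous_component d (p * q) =
     (\<Sum>e\<le>d. homogeneous_component e p * homogeneous_component (d - e) q)"
proof (induction p rule: mpoly_additive_induct)
  case (single a u)
  show ?case
  proof (induction q rule: mpoly_additive_induct)
    case (single b v)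
    have "(\<Sum>e\<le>d. homogeneous_component e (Poly_Mapping.single a u) *
          homogeneous_component (d - e) (Poly_Mapping.single b v)) =
        (\<Sum>e\<le>d. if mon_degree a = e then
          (if mon_degree b = d - mon_degree a then Poly_Mapping.single (a + b) (u * v) else 0) else 0)"
      by (intro sum.cong) (auto simp: homogeneous_component_single mult_single)
    also have "\<dots> = homogeneous_component d (Poly_Mapping.single a u * Poly_Mapping.single b v)"
      by (auto simp: mult_single homogeneous_component_single)
    finally show ?case by simp
  next
    case (add q r)
    then show ?case by (simp add: distrib_left homogeneous_component_add sum.distrib)
  qed
next
  case (add p r)
  then show ?case by (simp add: distrib_right homogeneous_component_add sum.distrib)
qed

text \<open>
  The component of degree \<open>d - c\<close>, read as zero for \<open>d < c\<close>: the coefficient that a generator of degree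
  \<open>c\<close> receives in the degree \<open>d\<close> part of a combination.
\<close>
definition shifted_component ::
    "nat \<Rightarrow> nat \<Rightarrow> ('n::finite, 'k::field_char_0) mpoly \<Rightarrow> ('n, 'k) mpoly" where
  "shifted_component d c p = (if c \<le> d then homogeneous_component (d - c) p else 0)"

lemma homogeneous_component_mult_left:
  assumes "f \<in> homogeneous_polys c"
  shows "homogeneous_component d (f * p) = f * shifted_component d c p"
proof -
  have "homogeneous_component d (f * p) = (\<Sum>e\<le>d. if e = c then f * homogeneous_component (d - c) p else 0)"
    unfolding homogeneous_component_mult
    by (intro sum.cong) (auto simp: homogeneous_component_homogeneous[OF assms])
  then show ?thesis by (simp add: shifted_component_def)
qed

lemma shifted_component_mult_left:
  assumes "f \<in> homogeneous_polys b"
  shows "shifted_component d c (f * p) = f * shifted_component d (b + c) p"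
  unfolding shifted_component_def homogeneous_component_mult_left[OF assms]
  by (auto simp: shifted_component_def add.commute)

lemma shifted_component_0 [simp]: "shifted_component d c 0 = 0"
  and shifted_component_add: "shifted_component d c (p + q) = shifted_component d c p + shifted_component d c q"
  and shifted_component_uminus: "shifted_component d c (- p) = - shifted_component d c p"
  and shifted_component_sum: "shifted_component d c (\<Sum>i\<in>A. f i) = (\<Sum>i\<in>A. shifted_component d c (f i))"
  and shifted_component_idem [simp]: "shifted_component d c (shifted_component d c p) = shifted_component d c p"
  by (simp_all add: shifted_component_def homogeneous_component_add homogeneous_component_uminus
      homogeneous_component_sum homogeneous_component_homogeneous[OF homogeneous_component_in])

lemma shifted_component_homogeneous:
  "p \<in> homogeneous_polys e \<Longrightarrow> shifted_component (e + c) c p = p"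
  by (simp add: shifted_component_def homogeneous_component_homogeneous)

text \<open>
  The power \<open>\<mm>\<^sup>k\<close> of the maximal ideal, described by the monomials that occur.
\<close>
definition order_ge :: "nat \<Rightarrow> ('n::finite, 'k::field_char_0) mpoly set" where
  "order_ge k = {p. \<forall>a\<in>Poly_Mapping.keys p. k \<le> mon_degree a}"

lemma order_ge_iff:
  "p \<in> order_ge k \<longleftrightarrow> (\<forall>a. Poly_Mapping.lookup p a \<noteq> 0 \<longrightarrow> k \<le> mon_degree a)"
  by (auto simp: order_ge_def in_keys_iff)

lemma order_ge_0 [simp]: "p \<in> order_ge 0"
  by (simp add: order_ge_def)

lemma zero_in_order_ge [simp]: "0 \<in> order_ge k"
  by (simp add: order_ge_def)

lemma order_ge_add: "p \<in> order_ge k \<Longrightarrow> q \<in> order_ge k \<Longrightarrow> p + q \<in> order_ge k"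
  using keys_add[of p q] unfolding order_ge_def by blast

lemma order_ge_sum: "(\<And>i. i \<in> A \<Longrightarrow> f i \<in> order_ge k) \<Longrightarrow> (\<Sum>i\<in>A. f i) \<in> order_ge k"
  by (induction A rule: infinite_finite_induct) (auto intro: order_ge_add)

lemma order_ge_mult:
  assumes "p \<in> order_ge j" and "q \<in> order_ge k"
  shows "p * q \<in> order_ge (j + k)"
  unfolding order_ge_def
proof (intro CollectI ballI)
  fix a assume "a \<in> Poly_Mapping.keys (p * q)"
  then obtain b c where "a = b + c" "b \<in> Poly_Mapping.keys p" "c \<in> Poly_Mapping.keys q"
    using keys_mult[of p q] by blast
  then show "j + k \<le> mon_degree a"
    using assms by (simp add: order_ge_def add_mono)
qed

lemma shifted_component_order_ge:
  "p \<in> order_ge k \<Longrightarrow> d < k \<Longrightarrow> shifted_component d c p = 0"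
  unfolding shifted_component_def order_ge_iff
  by (auto simp: lookup_homogeneous_component intro!: poly_mapping_eqI) (metis diff_le_self leD le_trans)

text \<open>
  The action on exponent vectors: \<open>\<sigma>\<close> maps the monomial with exponent \<open>a\<close> to the one with exponent
  \<open>perm_exponent \<sigma> a\<close>.
\<close>
definition perm_exponent :: "'n::finite perm \<Rightarrow> ('n \<Rightarrow>\<^sub>0 nat) \<Rightarrow> ('n \<Rightarrow>\<^sub>0 nat)" where
  "perm_exponent \<sigma> a = (\<Sum>i\<in>UNIV. Poly_Mapping.single (\<sigma> \<langle>$\<rangle> i) (Poly_Mapping.lookup a i))"

lemma perm_inverse_apply [simp]:
  "\<sigma> \<langle>$\<rangle> (inverse \<sigma> \<langle>$\<rangle> i) = i" "inverse \<sigma> \<langle>$\<rangle> (\<sigma> \<langle>$\<rangle> i) = i" for \<sigma> :: "'a perm"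
  by (simp_all add: apply_sequence)

lemma lookup_perm_exponent:
  "Poly_Mapping.lookup (perm_exponent \<sigma> a) j = Poly_Mapping.lookup a (inverse \<sigma> \<langle>$\<rangle> j)"
proof -
  have "\<sigma> \<langle>$\<rangle> i = j \<longleftrightarrow> i = inverse \<sigma> \<langle>$\<rangle> j" for i
    by (metis perm_inverse_apply)
  then show ?thesis
    by (simp add: perm_exponent_def lookup_sum lookup_single when_def)
qed

lemma perm_exponent_add: "perm_exponent \<sigma> (a + b) = perm_exponent \<sigma> a + perm_exponent \<sigma> b"
  by (rule poly_mapping_eqI) (simp add: lookup_perm_exponent lookup_add)

lemma perm_exponent_times: "perm_exponent (\<sigma> * \<tau>) a = perm_exponent \<sigma> (perm_exponent \<tau> a)"
proof (rule poly_mapping_eqI)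
  fix j
  show "Poly_Mapping.lookup (perm_exponent (\<sigma> * \<tau>) a) j
      = Poly_Mapping.lookup (perm_exponent \<sigma> (perm_exponent \<tau> a)) j"
    by (simp add: lookup_perm_exponent apply_times)
qed

lemma perm_exponent_1 [simp]: "perm_exponent 1 a = a"
  by (rule poly_mapping_eqI) (simp add: lookup_perm_exponent)

lemma mon_degree_perm_exponent [simp]: "mon_degree (perm_exponent \<sigma> a) = mon_degree a"
  unfolding mon_degree_def lookup_perm_exponent
  by (rule sum.reindex_bij_witness[of _ "apply \<sigma>" "apply (inverse \<sigma>)"]) auto

lemma Var_power: "Var i ^ k = Poly_Mapping.single (Poly_Mapping.single i k) 1"
  by (induction k) (simp_all add: Var_def mult_single flip: single_add)

lemma prod_single_1:
  "(\<Prod>i\<in>A. Poly_Mapping.single (f i) 1) = (Poly_Mapping.single (\<Sum>i\<in>A. f i) 1 :: ('n, 'k::field_char_0) mpoly)"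
  by (induction A rule: infinite_finite_induct) (simp_all add: mult_single)

lemma perm_vars_sum_monomials:
  "perm_vars \<sigma> p =
     (\<Sum>a\<in>Poly_Mapping.keys p. Poly_Mapping.single (perm_exponent \<sigma> a) (Poly_Mapping.lookup p a))"
  by (simp add: perm_vars_def Var_power prod_single_1 Const_def mult_single perm_exponent_def)

lemma lookup_perm_vars:
  "Poly_Mapping.lookup (perm_vars \<sigma> p) b = Poly_Mapping.lookup p (perm_exponent (inverse \<sigma>) b)"
proof -
  have "perm_exponent \<sigma> a = b \<longleftrightarrow> a = perm_exponent (inverse \<sigma>) b" for a
    by (auto simp flip: perm_exponent_times)
  then show ?thesis
    by (simp add: perm_vars_sum_monomials lookup_sum lookup_single when_def in_keys_iff)
qed

lemma perm_vars_add: "perm_vars \<sigma> (p + q) = perm_vars \<sigma> p + perm_vars \<sigma> q"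
  by (rule poly_mapping_eqI) (simp add: lookup_perm_vars lookup_add)

lemma perm_vars_0 [simp]: "perm_vars \<sigma> 0 = 0"
  by (rule poly_mapping_eqI) (simp add: lookup_perm_vars)

lemma perm_vars_sum: "perm_vars \<sigma> (\<Sum>i\<in>A. f i) = (\<Sum>i\<in>A. perm_vars \<sigma> (f i))"
  by (induction A rule: infinite_finite_induct) (auto simp: perm_vars_add)

lemma perm_vars_Const_mult: "perm_vars \<sigma> (Const c * p) = Const c * perm_vars \<sigma> p"
  by (rule poly_mapping_eqI) (simp add: lookup_perm_vars)

lemma linear_perm_vars:
  "Vector_Spaces.linear (\<lambda>c p. Const c * p) (\<lambda>c p. Const c * p)
     (perm_vars \<sigma> :: ('n::finite, 'k::field_char_0) mpoly \<Rightarrow> _)"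
  by unfold_locales (simp_all add: perm_vars_add perm_vars_Const_mult)

lemma perm_vars_times: "perm_vars (\<sigma> * \<tau>) p = perm_vars \<sigma> (perm_vars \<tau> p)"
proof (rule poly_mapping_eqI)
  fix b
  show "Poly_Mapping.lookup (perm_vars (\<sigma> * \<tau>) p) b
      = Poly_Mapping.lookup (perm_vars \<sigma> (perm_vars \<tau> p)) b"
    by (simp add: lookup_perm_vars perm_exponent_times)
qed

lemma perm_vars_1 [simp]: "perm_vars 1 p = p"
  by (rule poly_mapping_eqI) (simp add: lookup_perm_vars)

lemma perm_vars_homogeneous: "p \<in> homogeneous_polys d \<Longrightarrow> perm_vars \<sigma> p \<in> homogeneous_polys d"
  by (force simp: homogeneous_polys_iff lookup_perm_vars)

lemma perm_vars_order_ge: "p \<in> order_ge k \<Longrightarrow> perm_vars \<sigma> p \<in> order_ge k"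
  by (force simp: order_ge_iff lookup_perm_vars)

lemma perm_vars_single:
  "perm_vars \<sigma> (Poly_Mapping.single a u) = Poly_Mapping.single (perm_exponent \<sigma> a) u"
  by (simp add: perm_vars_sum_monomials)

lemma perm_vars_mult: "perm_vars \<sigma> (p * q) = perm_vars \<sigma> p * perm_vars \<sigma> q"
proof (induction p rule: mpoly_additive_induct)
  case (single a u)
  show ?case
    by (induction q rule: mpoly_additive_induct)
      (simp_all add: mult_single perm_vars_single perm_exponent_add distrib_left perm_vars_add)
qed (simp add: distrib_right perm_vars_add)

section \<open>Ideals of the polynomial ring\<close>

lemma poly_ring_simps [simp]:
  "carrier poly_ring = UNIV" "(\<otimes>\<^bsub>poly_ring\<^esub>) = (*)" "(\<oplus>\<^bsub>poly_ring\<^esub>) = (+)"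
  "\<zero>\<^bsub>poly_ring\<^esub> = 0" "\<one>\<^bsub>poly_ring\<^esub> = 1" "(\<odot>\<^bsub>poly_ring\<^esub>) = (\<lambda>c p. Const c * p)"
  "gact poly_ring = perm_vars" "gcomp poly_ring = homogeneous_polys"
  by (simp_all add: poly_ring_def)

lemma cring_poly_ring: "cring (poly_ring :: ('n::finite, 'k::field_char_0, ('n, 'k) mpoly) graded_rep)"
proof (rule cringI)
  show "abelian_group (poly_ring :: ('n, 'k, ('n, 'k) mpoly) graded_rep)"
    by (rule abelian_groupI) (auto simp: algebra_simps intro: exI[of _ "- _"])
  show "comm_monoid (poly_ring :: ('n, 'k, ('n, 'k) mpoly) graded_rep)"
    by (rule comm_monoidI) (auto simp: algebra_simps)
qed (simp add: algebra_simps)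

lemma ideal_poly_ringI:
  fixes I :: "('n::finite, 'k::field_char_0) mpoly set"
  assumes "0 \<in> I" and "\<And>x y. x \<in> I \<Longrightarrow> y \<in> I \<Longrightarrow> x + y \<in> I" and "\<And>r x. x \<in> I \<Longrightarrow> r * x \<in> I"
  shows "ideal I poly_ring"
proof -
  interpret cring "poly_ring :: ('n, 'k, ('n, 'k) mpoly) graded_rep" by (rule cring_poly_ring)
  have neg: "\<ominus>\<^bsub>poly_ring\<^esub> x = - x" for x :: "('n, 'k) mpoly"
    by (rule minus_equality) simp_all
  show ?thesis
  proof (rule idealI)
    show "Group.subgroup I (add_monoid poly_ring)"
    proof (rule add.subgroupI)
      fix x assume "x \<in> I"
      then show "\<ominus>\<^bsub>poly_ring\<^esub> x \<in> I" using assms(3)[of x "-1"] by (simp add: neg)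
    next
      show "I \<noteq> {}" using assms(1) by blast
    qed (use assms(2) in auto)
  qed (use assms in \<open>auto simp: ring_axioms mult.commute\<close>)
qed

lemma ideal_poly_ringD:
  fixes I :: "('n::finite, 'k::field_char_0) mpoly set"
  assumes "ideal I poly_ring"
  shows "0 \<in> I" "x \<in> I \<Longrightarrow> y \<in> I \<Longrightarrow> x + y \<in> I" "x \<in> I \<Longrightarrow> r * x \<in> I" "mpoly.subspace I"
proof -
  note sub = ideal.axioms(1)[OF assms]
  show 1: "0 \<in> I" using additive_subgroup.zero_closed[OF sub] by simp
  show 2: "x + y \<in> I" if "x \<in> I" "y \<in> I" for x y using additive_subgroup.a_closed[OF sub] that by simp
  show 3: "r * x \<in> I" if "x \<in> I" for x r using ideal.I_l_closed[OF assms, of x r] that by simp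
  show "mpoly.subspace I" by (rule mpoly.subspaceI) (auto intro: 1 2 3)
qed

definition ideal_span :: "(nat \<Rightarrow> 'a::comm_ring_1) \<Rightarrow> nat \<Rightarrow> 'a set" where
  "ideal_span f k = range (\<lambda>a. \<Sum>i<k. a i * f i)"

lemma in_ideal_spanI: "x = (\<Sum>i<k. a i * f i) \<Longrightarrow> x \<in> ideal_span f k"
  unfolding ideal_span_def by (rule range_eqI[where x = a])

lemma ideal_ideal_span: "ideal (ideal_span f k) poly_ring"
proof (rule ideal_poly_ringI)
  show "0 \<in> ideal_span f k"
    by (rule in_ideal_spanI[of _ "\<lambda>_. 0"]) simp
next
  fix x y assume "x \<in> ideal_span f k" "y \<in> ideal_span f k"
  then obtain a b where "x = (\<Sum>i<k. a i * f i)" "y = (\<Sum>i<k. b i * f i)"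
    by (auto simp: ideal_span_def)
  then have "x + y = (\<Sum>i<k. (a i + b i) * f i)" by (simp add: sum.distrib distrib_right)
  then show "x + y \<in> ideal_span f k" by (rule in_ideal_spanI)
next
  fix r x assume "x \<in> ideal_span f k"
  then obtain a where "x = (\<Sum>i<k. a i * f i)" by (auto simp: ideal_span_def)
  then have "r * x = (\<Sum>i<k. (r * a i) * f i)" by (simp add: sum_distrib_left mult.assoc)
  then show "r * x \<in> ideal_span f k" by (rule in_ideal_spanI)
qed

lemma in_ideal_span: "i < k \<Longrightarrow> f i \<in> ideal_span f k"
  unfolding ideal_span_def
  by (rule range_eqI[of _ _ "\<lambda>j. if j = i then 1 else 0"]) (simp add: if_distribR if_distrib[of "\<lambda>x. x * _"] cong: if_cong)

lemma ideal_sum: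
  fixes I :: "('n::finite, 'k::field_char_0) mpoly set"
  assumes "ideal I poly_ring" and "\<And>i. i \<in> A \<Longrightarrow> x i \<in> I"
  shows "(\<Sum>i\<in>A. x i) \<in> I"
  using mpoly.subspace_sum[OF ideal_poly_ringD(4)[OF assms(1)]] assms(2) by blast

lemma Idl_poly_ring_image:
  fixes f :: "nat \<Rightarrow> ('n::finite, 'k::field_char_0) mpoly"
  shows "Idl\<^bsub>poly_ring\<^esub> (f ` {..<k}) = ideal_span f k"
proof -
  interpret cring "poly_ring :: ('n, 'k, ('n, 'k) mpoly) graded_rep" by (rule cring_poly_ring)
  show ?thesis
  proof
    show "Idl\<^bsub>poly_ring\<^esub> (f ` {..<k}) \<subseteq> ideal_span f k"
      by (rule genideal_minimal[OF ideal_ideal_span]) (auto intro: in_ideal_span)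
    have I: "ideal (Idl\<^bsub>poly_ring\<^esub> (f ` {..<k})) poly_ring" by (rule genideal_ideal) simp
    have "f i \<in> Idl\<^bsub>poly_ring\<^esub> (f ` {..<k})" if "i < k" for i
      using genideal_self[of "f ` {..<k}"] that by auto
    then show "ideal_span f k \<subseteq> Idl\<^bsub>poly_ring\<^esub> (f ` {..<k})"
      unfolding ideal_span_def by (auto intro!: ideal_sum[OF I] ideal_poly_ringD(3)[OF I])
  qed
qed

lemma Idl_poly_ring_take:
  assumes "k \<le> length fs"
  shows "Idl\<^bsub>poly_ring\<^esub> (set (take k fs)) = ideal_span ((!) fs) k"
proof -
  have "set (take k fs) = (!) fs ` {..<k}"
    using nth_image[OF assms] by (simp add: lessThan_atLeast0)
  then show ?thesis by (simp add: Idl_poly_ring_image)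
qed

lemma ideal_order_ge: "ideal (order_ge k) poly_ring"
  by (rule ideal_poly_ringI) (use order_ge_add order_ge_mult[OF order_ge_0] in auto)

lemma max_ideal_eq_order_ge: "max_ideal = (order_ge 1 :: ('n::finite, 'k::field_char_0) mpoly set)"
proof -
  interpret cring "poly_ring :: ('n, 'k, ('n, 'k) mpoly) graded_rep" by (rule cring_poly_ring)
  let ?M = "max_ideal :: ('n, 'k) mpoly set"
  have M: "ideal ?M poly_ring" unfolding max_ideal_def by (rule genideal_ideal) simp
  have "?M \<subseteq> order_ge 1"
    unfolding max_ideal_def
    by (rule genideal_minimal[OF ideal_order_ge]) (auto simp: order_ge_def Var_def)
  moreover have "p \<in> ?M" if "p \<in> order_ge 1" for p
  proof -
    have "Poly_Mapping.single a u \<in> ?M" if "1 \<le> mon_degree a" for a u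
    proof -
      obtain i where "Poly_Mapping.lookup a i \<noteq> 0"
        using \<open>1 \<le> mon_degree a\<close> unfolding mon_degree_def
        by (metis not_one_le_zero sum.neutral)
      then have "a = (a - Poly_Mapping.single i 1) + Poly_Mapping.single i 1"
        by (intro poly_mapping_eqI) (auto simp: lookup_add lookup_minus lookup_single when_def)
      then have "Poly_Mapping.single a u = Poly_Mapping.single (a - Poly_Mapping.single i 1) u * Var i"
        by (simp add: Var_def mult_single)
      moreover have "Var i \<in> ?M"
        using genideal_self[of "range Var"] unfolding max_ideal_def by auto
      ultimately show ?thesis using ideal_poly_ringD(3)[OF M] by simp
    qed
    then have "(\<Sum>a\<in>Poly_Mapping.keys p. Poly_Mapping.single a (Poly_Mapping.lookup p a)) \<in> ?M"
      using that by (intro ideal_sum[OF M]) (auto simp: order_ge_def)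
    then show ?thesis using mpoly_sum_monomials[of p] by simp
  qed
  ultimately show ?thesis by blast
qed

section \<open>Koszul syzygies\<close>

text \<open>
  The diagonal condition does not follow from antisymmetry in rings where \<open>2\<close> is a zero divisor.
\<close>
definition alternating :: "nat \<Rightarrow> (nat \<Rightarrow> nat \<Rightarrow> 'a::comm_ring_1) \<Rightarrow> bool" where
  "alternating k S \<longleftrightarrow> (\<forall>i<k. S i i = 0) \<and> (\<forall>i<k. \<forall>j<k. S i j = - S j i)"

definition koszul_syzygy :: "(nat \<Rightarrow> 'a::comm_ring_1) \<Rightarrow> nat \<Rightarrow> (nat \<Rightarrow> 'a) \<Rightarrow> bool" where
  "koszul_syzygy f k a \<longleftrightarrow> (\<exists>S. alternating k S \<and> (\<forall>i<k. a i = (\<Sum>j<k. S i j * f j)))"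

lemma alternating_antisym: "alternating k S \<Longrightarrow> i < k \<Longrightarrow> j < k \<Longrightarrow> S i j = - S j i"
  and alternating_diag: "alternating k S \<Longrightarrow> i < k \<Longrightarrow> S i i = 0"
  unfolding alternating_def by blast+

lemma alternating_mono: "alternating k S \<Longrightarrow> l \<le> k \<Longrightarrow> alternating l S"
  unfolding alternating_def by (meson less_le_trans)

lemma alternating_add:
  assumes "alternating k S" and "alternating k S'"
  shows "alternating k (\<lambda>i j. S i j + S' i j * c)"
  unfolding alternating_def
proof (intro conjI allI impI)
  fix i j assume ij: "i < k" "j < k"
  show "S i j + S' i j * c = - (S j i + S' j i * c)"
    using alternating_antisym[OF assms(1) ij] alternating_antisym[OF assms(2) ij] by simp
qed (simp add: alternating_diag[OF assms(1)] alternating_diag[OF assms(2)])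

lemma alternating_sum_eq_0:
  fixes S :: "nat \<Rightarrow> nat \<Rightarrow> 'a::comm_ring_1"
  assumes "alternating k S"
  shows "(\<Sum>i<k. (\<Sum>j<k. S i j * f j) * f i) = 0"
  using assms
proof (induction k)
  case (Suc k)
  have "(\<Sum>i<k. S i k * f k * f i) = (\<Sum>i<k. - (S k i * f i * f k))"
  proof (rule sum.cong)
    fix i assume "i \<in> {..<k}"
    then have "S i k = - S k i" by (intro alternating_antisym[OF Suc.prems]) auto
    then show "S i k * f k * f i = - (S k i * f i * f k)" by (simp add: mult_ac)
  qed simp
  moreover have "alternating k S" using Suc.prems by (rule alternating_mono) simp
  ultimately show ?case
    using Suc.IH alternating_diag[OF Suc.prems, of k]
    by (simp add: distrib_right sum.distrib sum_negf sum_distrib_right)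
qed simp

text \<open>
  The matrix in the conclusion is \<open>B\<^sup>T S B\<close>.
\<close>
lemma alternating_congruence:
  fixes S :: "nat \<Rightarrow> nat \<Rightarrow> 'a::comm_ring_1"
  assumes "alternating r S"
  shows "alternating m (\<lambda>j j'. \<Sum>k<r. (\<Sum>l<r. S k l * B l j') * B k j)"
  unfolding alternating_def
proof (intro conjI allI impI)
  fix i j
  show "(\<Sum>k<r. (\<Sum>l<r. S k l * B l i) * B k i) = 0"
    using alternating_sum_eq_0[OF assms, of "\<lambda>l. B l i"] .
  have "(\<Sum>k<r. (\<Sum>l<r. S k l * B l j) * B k i) = (\<Sum>k<r. \<Sum>l<r. S k l * B l j * B k i)"
    by (simp add: sum_distrib_right)
  also have "\<dots> = (\<Sum>l<r. \<Sum>k<r. S k l * B l j * B k i)"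
    by (rule sum.swap)
  also have "\<dots> = (\<Sum>l<r. \<Sum>k<r. - (S l k * B k i * B l j))"
  proof (intro sum.cong refl)
    fix k l assume "k \<in> {..<r}" "l \<in> {..<r}"
    then have "S k l = - S l k" by (intro alternating_antisym[OF assms]) auto
    then show "S k l * B l j * B k i = - (S l k * B k i * B l j)" by (simp add: mult_ac)
  qed
  also have "\<dots> = - (\<Sum>l<r. (\<Sum>k<r. S l k * B k i) * B l j)"
    by (simp add: sum_negf sum_distrib_right)
  finally show "(\<Sum>k<r. (\<Sum>l<r. S k l * B l j) * B k i) = - (\<Sum>k<r. (\<Sum>l<r. S k l * B l i) * B k j)" .
qed

text \<open>
  Regularity of the last element expresses its coefficient as \<open>a\<^sub>r = \<Sum> s\<^sub>i g\<^sub>i\<close>, and adding the Koszul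
  relations between \<open>g\<^sub>i\<close> and \<open>g\<^sub>r\<close> with coefficients \<open>s\<^sub>i\<close> reduces to a syzygy of the first \<open>r\<close> elements.
\<close>
lemma regular_imp_koszul_syzygy:
  fixes g :: "nat \<Rightarrow> 'a::comm_ring_1"
  assumes "\<And>i h. i < r \<Longrightarrow> h * g i \<in> ideal_span g i \<Longrightarrow> h \<in> ideal_span g i"
    and "(\<Sum>i<r. a i * g i) = 0"
  shows "koszul_syzygy g r a"
  using assms
proof (induction r arbitrary: a)
  case 0
  show ?case by (auto simp: koszul_syzygy_def alternating_def)
next
  case (Suc r)
  have "a r * g r = (\<Sum>i<r. (- a i) * g i)"
    using Suc.prems(2) by (simp add: sum_negf eq_neg_iff_add_eq_0 add.commute)
  then have "a r * g r \<in> ideal_span g r" by (rule in_ideal_spanI)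
  then obtain s where s: "a r = (\<Sum>i<r. s i * g i)"
    using Suc.prems(1)[of r "a r"] by (auto simp: ideal_span_def)
  have "(\<Sum>i<r. (a i + s i * g r) * g i) = (\<Sum>i<r. a i * g i) + (\<Sum>i<r. s i * g i) * g r"
    by (simp add: algebra_simps sum.distrib sum_distrib_left)
  also have "\<dots> = 0" using Suc.prems(2) s by simp
  finally have "koszul_syzygy g r (\<lambda>i. a i + s i * g r)"
    using Suc.IH Suc.prems(1) by simp
  then obtain S where S: "alternating r S" "\<And>i. i < r \<Longrightarrow> a i + s i * g r = (\<Sum>j<r. S i j * g j)"
    by (auto simp: koszul_syzygy_def)
  \<comment> \<open>\<open>S\<close> bordered by the last row \<open>s\<close> and the last column \<open>- s\<close>\<close>
  define S' where "S' i j = (if i < r then if j < r then S i j else - s i else if j < r then s j else 0)" for i j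
  have "alternating (Suc r) S'"
    unfolding alternating_def
  proof (intro conjI allI impI)
    fix i j assume "i < Suc r" "j < Suc r"
    then show "S' i j = - S' j i"
      using alternating_antisym[OF S(1), of i j] by (simp add: S'_def)
  qed (simp add: S'_def alternating_diag[OF S(1)])
  moreover have "a i = (\<Sum>j<Suc r. S' i j * g j)" if "i < Suc r" for i
  proof (cases "i < r")
    case True
    then show ?thesis using S(2)[OF True] by (simp add: S'_def eq_diff_eq)
  next
    case False
    then show ?thesis using s that by (simp add: S'_def less_Suc_eq)
  qed
  ultimately show ?case unfolding koszul_syzygy_def by blast
qed

text \<open>
  A syzygy \<open>a\<close> of \<open>f = A g\<close> yields the syzygy \<open>a A\<close> of \<open>g\<close>, hence \<open>a A = S g = S B f\<close> with \<open>S\<close> alternating, and so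
  \<open>a A B = (B\<^sup>T S B) f\<close>.
\<close>
lemma koszul_syzygy_change_generators:
  fixes f g :: "nat \<Rightarrow> 'a::comm_ring_1"
  assumes koszul: "\<And>b. (\<Sum>k<r. b k * g k) = 0 \<Longrightarrow> koszul_syzygy g r b"
    and f: "\<And>i. i < m \<Longrightarrow> f i = (\<Sum>k<r. A i k * g k)"
    and g: "\<And>k. k < r \<Longrightarrow> g k = (\<Sum>j<m. B k j * f j)"
    and a: "(\<Sum>i<m. a i * f i) = 0"
  shows "koszul_syzygy f m (\<lambda>j. \<Sum>i<m. a i * (\<Sum>k<r. A i k * B k j))"
proof -
  define b where "b k = (\<Sum>i<m. a i * A i k)" for k
  have "(\<Sum>k<r. b k * g k) = (\<Sum>k<r. \<Sum>i<m. a i * (A i k * g k))"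
    by (simp add: b_def sum_distrib_right mult.assoc)
  also have "\<dots> = (\<Sum>i<m. a i * (\<Sum>k<r. A i k * g k))"
    by (subst sum.swap) (simp add: sum_distrib_left)
  also have "\<dots> = 0" using a f by simp
  finally obtain S where S: "alternating r S" "\<And>k. k < r \<Longrightarrow> b k = (\<Sum>l<r. S k l * g l)"
    using koszul unfolding koszul_syzygy_def by blast
  define S' where "S' j j' = (\<Sum>k<r. (\<Sum>l<r. S k l * B l j') * B k j)" for j j'
  have b: "b k = (\<Sum>j<m. (\<Sum>l<r. S k l * B l j) * f j)" if "k < r" for k
  proof -
    have "b k = (\<Sum>l<r. \<Sum>j<m. S k l * B l j * f j)"
      unfolding S(2)[OF that]
      by (intro sum.cong refl) (subst g, simp_all add: sum_distrib_left mult.assoc)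
    then show ?thesis by (subst (asm) sum.swap) (simp add: sum_distrib_right)
  qed
  have "(\<Sum>i<m. a i * (\<Sum>k<r. A i k * B k j)) = (\<Sum>j'<m. S' j j' * f j')" for j
  proof -
    have "(\<Sum>i<m. a i * (\<Sum>k<r. A i k * B k j)) = (\<Sum>i<m. \<Sum>k<r. a i * A i k * B k j)"
      by (simp add: sum_distrib_left mult.assoc)
    also have "\<dots> = (\<Sum>k<r. b k * B k j)"
      by (subst sum.swap) (simp add: b_def sum_distrib_right)
    also have "\<dots> = (\<Sum>k<r. \<Sum>j'<m. (\<Sum>l<r. S k l * B l j') * B k j * f j')"
      by (intro sum.cong refl) (simp add: b sum_distrib_right sum_distrib_left mult_ac)
    also have "\<dots> = (\<Sum>j'<m. S' j j' * f j')"
      by (subst sum.swap) (simp add: S'_def sum_distrib_right)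
    finally show ?thesis .
  qed
  moreover have "alternating m S'"
    unfolding S'_def by (rule alternating_congruence[OF S(1)])
  ultimately show ?thesis unfolding koszul_syzygy_def by blast
qed

text \<open>
  Since \<open>a = a A B + a (1 - A B)\<close>, every syzygy is a Koszul syzygy plus \<open>a (1 - A B)\<close>. The entries of
  \<open>1 - A B\<close> have no constant term by minimality, so each application of this identity to the error term
  raises its order by one.
\<close>
lemma koszul_syzygy_approximation:
  fixes f :: "nat \<Rightarrow> ('n::finite, 'k::field_char_0) mpoly"
  assumes koszul: "\<And>b. (\<Sum>k<r. b k * g k) = 0 \<Longrightarrow> koszul_syzygy g r b"
    and f: "\<And>i. i < m \<Longrightarrow> f i = (\<Sum>k<r. A i k * g k)"
    and g: "\<And>k. k < r \<Longrightarrow> g k = (\<Sum>j<m. B k j * f j)"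
    and minimal: "\<And>b i. (\<Sum>i<m. b i * f i) = 0 \<Longrightarrow> i < m \<Longrightarrow> b i \<in> order_ge 1"
    and a: "(\<Sum>i<m. a i * f i) = 0"
  shows "\<exists>S z. alternating m S \<and> (\<forall>i<m. z i \<in> order_ge N \<and> a i = (\<Sum>j<m. S i j * f j) + z i)
           \<and> (\<Sum>i<m. z i * f i) = 0"
proof (induction N)
  case 0
  show ?case using a by (intro exI[of _ "\<lambda>_ _. 0"] exI[of _ a]) (simp add: alternating_def)
next
  case (Suc N)
  then obtain S z where S: "alternating m S" and z: "\<And>i. i < m \<Longrightarrow> z i \<in> order_ge N"
      "\<And>i. i < m \<Longrightarrow> a i = (\<Sum>j<m. S i j * f j) + z i" "(\<Sum>i<m. z i * f i) = 0"
    by blast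
  define C where "C i j = (\<Sum>k<r. A i k * B k j)" for i j
  \<comment> \<open>\<open>C = A B\<close> and \<open>E = 1 - A B\<close>\<close>
  define E where "E i j = (if i = j then 1 else 0) - C i j" for i j
  have E: "E i j \<in> order_ge 1" if ij: "i < m" "j < m" for i j
  proof (rule minimal[OF _ ij(2)])
    have "(\<Sum>j<m. C i j * f j) = (\<Sum>j<m. \<Sum>k<r. A i k * (B k j * f j))"
      by (simp add: C_def sum_distrib_right mult.assoc)
    also have "\<dots> = (\<Sum>k<r. A i k * g k)"
      by (subst sum.swap) (simp add: g sum_distrib_left)
    also have "\<dots> = f i" using f ij by simp
    finally have "(\<Sum>j<m. C i j * f j) = f i" .
    moreover have "(\<Sum>j<m. (if i = j then 1 else 0) * f j) = f i"
      using ij by (simp add: if_distribR if_distrib[of "\<lambda>x. x * _"] cong: if_cong)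
    ultimately show "(\<Sum>j<m. E i j * f j) = 0"
      by (simp add: E_def left_diff_distrib sum_subtractf)
  qed
  define y where "y j = (\<Sum>i<m. z i * E i j)" for j
  have "koszul_syzygy f m (\<lambda>j. \<Sum>i<m. z i * C i j)"
    unfolding C_def by (rule koszul_syzygy_change_generators[OF koszul f g z(3)])
  then obtain S' where S': "alternating m S'"
      "\<And>j. j < m \<Longrightarrow> (\<Sum>i<m. z i * C i j) = (\<Sum>j'<m. S' j j' * f j')"
    unfolding koszul_syzygy_def by blast
  have zy: "z j = (\<Sum>j'<m. S' j j' * f j') + y j" if "j < m" for j
  proof -
    have "y j = (\<Sum>i<m. if i = j then z j else 0) - (\<Sum>i<m. z i * C i j)"
      unfolding y_def E_def right_diff_distrib sum_subtractf
      by (intro arg_cong2[of _ _ _ _ "(-)"] sum.cong) auto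
    then show ?thesis using that S'(2)[OF that] by simp
  qed
  have "y j \<in> order_ge (Suc N)" if "j < m" for j
    unfolding y_def using order_ge_mult[OF z(1) E[OF _ that]] by (intro order_ge_sum) simp
  moreover have "alternating m (\<lambda>i j. S i j + S' i j)"
    using alternating_add[OF S S'(1), of 1] by simp
  moreover have "a i = (\<Sum>j<m. (S i j + S' i j) * f j) + y i" if "i < m" for i
    using z(2)[OF that] zy[OF that] by (simp add: distrib_right sum.distrib add.assoc)
  moreover have "(\<Sum>i<m. y i * f i) = 0"
  proof -
    have "(\<Sum>i<m. z i * f i) = (\<Sum>i<m. (\<Sum>j<m. S' i j * f j) * f i) + (\<Sum>i<m. y i * f i)"
      unfolding sum.distrib[symmetric] by (rule sum.cong) (auto simp: zy distrib_right)
    then show ?thesis using z(3) alternating_sum_eq_0[OF S'(1)] by simp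
  qed
  ultimately show ?case by blast
qed

text \<open>
  The syzygy \<open>a\<close> is homogeneous of total degree \<open>d\<close>, that is, \<open>a i\<close> has degree \<open>d - c i\<close>. Taking components
  of total degree \<open>d\<close> in \<open>a = S f + z\<close> kills the error \<open>z\<close>, and the entry \<open>S i j\<close> contributes its component of
  degree \<open>d - c i - c j\<close>, which is symmetric in \<open>i\<close> and \<open>j\<close> and so keeps the matrix alternating.
\<close>
lemma koszul_syzygy_homogenize:
  assumes f: "\<And>i. i < k \<Longrightarrow> f i \<in> homogeneous_polys (c i)"
    and S: "alternating k S"
    and z: "\<And>i. i < k \<Longrightarrow> z i \<in> order_ge (Suc d)"
    and a: "\<And>i. i < k \<Longrightarrow> a i = (\<Sum>j<k. S i j * f j) + z i"
    and hom: "\<And>i. i < k \<Longrightarrow> shifted_component d (c i) (a i) = a i"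
  shows "alternating k (\<lambda>i j. shifted_component d (c i + c j) (S i j))"
    and "\<And>i. i < k \<Longrightarrow> a i = (\<Sum>j<k. shifted_component d (c i + c j) (S i j) * f j)"
proof -
  show "alternating k (\<lambda>i j. shifted_component d (c i + c j) (S i j))"
    unfolding alternating_def
  proof (intro conjI allI impI)
    fix i j assume "i < k" "j < k"
    then have "S i j = - S j i" by (rule alternating_antisym[OF S])
    then show "shifted_component d (c i + c j) (S i j) = - shifted_component d (c j + c i) (S j i)"
      by (simp add: shifted_component_uminus add.commute)
  qed (simp add: alternating_diag[OF S])
next
  fix i assume i: "i < k"
  have "a i = shifted_component d (c i) ((\<Sum>j<k. f j * S i j) + z i)"
    using hom[OF i] a[OF i] by (simp add: mult.commute)
  also have "\<dots> = (\<Sum>j<k. f j * shifted_component d (c j + c i) (S i j))"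
    unfolding shifted_component_add shifted_component_sum
      shifted_component_order_ge[OF z[OF i] lessI] add_0_right
    by (intro sum.cong refl shifted_component_mult_left) (simp add: f)
  finally show "a i = (\<Sum>j<k. shifted_component d (c i + c j) (S i j) * f j)"
    by (simp add: mult.commute add.commute)
qed

text \<open>
  Vanishing of the first Koszul homology of \<open>f 0, \<dots>, f (k - 1)\<close>, tested on syzygies of every total
  degree \<open>d\<close>, where \<open>f i\<close> has degree \<open>c i\<close>.
\<close>
definition homogeneous_syzygies_koszul ::
    "(nat \<Rightarrow> ('n::finite, 'k::field_char_0) mpoly) \<Rightarrow> (nat \<Rightarrow> nat) \<Rightarrow> nat \<Rightarrow> bool" where
  "homogeneous_syzygies_koszul f c k \<longleftrightarrow>
     (\<forall>d a. (\<forall>i<k. shifted_component d (c i) (a i) = a i) \<longrightarrow> (\<Sum>i<k. a i * f i) = 0 \<longrightarrow>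
        koszul_syzygy f k a)"

text \<open>
  Both sequences generate the same ideal, and \<open>f\<close> does so minimally. An error of order greater than
  \<open>d\<close> is invisible in total degree \<open>d\<close>, so one sufficiently good approximation is enough.
\<close>
lemma minimal_generators_syzygies_koszul:
  fixes f :: "nat \<Rightarrow> ('n::finite, 'k::field_char_0) mpoly"
  assumes koszul: "\<And>b. (\<Sum>k<r. b k * g k) = 0 \<Longrightarrow> koszul_syzygy g r b"
    and hom: "\<And>i. i < m \<Longrightarrow> f i \<in> homogeneous_polys (c i)"
    and span: "ideal_span f m = ideal_span g r"
    and minimal: "\<And>b i. (\<Sum>i<m. b i * f i) = 0 \<Longrightarrow> i < m \<Longrightarrow> b i \<in> order_ge 1"
  shows "homogeneous_syzygies_koszul f c m"
  unfolding homogeneous_syzygies_koszul_def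
proof (intro allI impI)
  fix d a
  assume a: "\<forall>i<m. shifted_component d (c i) (a i) = a i" and 0: "(\<Sum>i<m. a i * f i) = 0"
  have "f i \<in> ideal_span g r" if "i < m" for i
    using in_ideal_span[OF that, of f] unfolding span .
  then have "\<forall>i. \<exists>x. i < m \<longrightarrow> f i = (\<Sum>k<r. x k * g k)"
    unfolding ideal_span_def by blast
  then obtain A where A: "\<And>i. i < m \<Longrightarrow> f i = (\<Sum>k<r. A i k * g k)"
    by (elim choice[THEN exE]) blast
  have "g k \<in> ideal_span f m" if "k < r" for k
    using in_ideal_span[OF that, of g] unfolding span .
  then have "\<forall>k. \<exists>x. k < r \<longrightarrow> g k = (\<Sum>j<m. x j * f j)"
    unfolding ideal_span_def by blast
  then obtain B where B: "\<And>k. k < r \<Longrightarrow> g k = (\<Sum>j<m. B k j * f j)"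
    by (elim choice[THEN exE]) blast
  have "\<exists>S z. alternating m S \<and>
      (\<forall>i<m. z i \<in> order_ge (Suc d) \<and> a i = (\<Sum>j<m. S i j * f j) + z i) \<and> (\<Sum>i<m. z i * f i) = 0"
    by (rule koszul_syzygy_approximation[where f = f and g = g and A = A and B = B and r = r])
      (fact koszul A B minimal 0)+
  then obtain S z where S: "alternating m S" "\<And>i. i < m \<Longrightarrow> z i \<in> order_ge (Suc d)"
      "\<And>i. i < m \<Longrightarrow> a i = (\<Sum>j<m. S i j * f j) + z i"
    by blast
  have a': "shifted_component d (c i) (a i) = a i" if "i < m" for i
    using a that by blast
  show "koszul_syzygy f m a"
    unfolding koszul_syzygy_def
  proof (intro exI conjI allI impI)
    show "alternating m (\<lambda>i j. shifted_component d (c i + c j) (S i j))"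
      by (rule koszul_syzygy_homogenize(1)[of m f c S z d a]) (fact hom S a')+
    show "a i = (\<Sum>j<m. shifted_component d (c i + c j) (S i j) * f j)" if "i < m" for i
      by (rule koszul_syzygy_homogenize(2)[of m f c S z d a]) (fact hom S a' that)+
  qed
qed

lemma shifted_component_add_shift:
  "c \<le> d \<Longrightarrow> shifted_component d (b + c) p = shifted_component (d - c) b p"
  by (auto simp: shifted_component_def add.commute)

text \<open>
  A syzygy \<open>a\<close> of the first \<open>k\<close> elements, extended by zero, is \<open>S f\<close> with \<open>S\<close> alternating of size \<open>k + 1\<close>. The
  last row shows that the last column \<open>s\<close> of \<open>S\<close> is a syzygy of the first \<open>k\<close> elements, of the smaller total
  degree \<open>d - c k\<close>. By induction \<open>s\<close> is Koszul, and so is \<open>a\<close>, which differs from a Koszul syzygy by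
  \<open>f k\<close> times \<open>s\<close>.
\<close>
lemma homogeneous_syzygies_koszul_descend:
  fixes f :: "nat \<Rightarrow> ('n::finite, 'k::field_char_0) mpoly"
  assumes K: "homogeneous_syzygies_koszul f c (Suc k)"
    and f: "\<And>i. i \<le> k \<Longrightarrow> f i \<in> homogeneous_polys (c i)" and ck: "0 < c k"
  shows "homogeneous_syzygies_koszul f c k"
proof -
  have "koszul_syzygy f k a"
    if "\<forall>i<k. shifted_component d (c i) (a i) = a i" "(\<Sum>i<k. a i * f i) = 0" for d a
    using that
  proof (induction d arbitrary: a rule: less_induct)
    case (less d)
    define a' where "a' i = (if i < k then a i else 0)" for i
    have hom: "shifted_component d (c i) (a' i) = a' i" if "i < Suc k" for i
      using less.prems(1) by (simp add: a'_def)
    have "koszul_syzygy f (Suc k) a'"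
    proof (rule K[unfolded homogeneous_syzygies_koszul_def, rule_format])
      show "(\<Sum>i<Suc k. a' i * f i) = 0" using less.prems(2) by (simp add: a'_def)
    qed (rule hom)
    then obtain S0 where S0: "alternating (Suc k) S0" "\<And>i. i < Suc k \<Longrightarrow> a' i = (\<Sum>j<Suc k. S0 i j * f j)"
      unfolding koszul_syzygy_def by blast
    define S where "S i j = shifted_component d (c i + c j) (S0 i j)" for i j
    have S0': "a' i = (\<Sum>j<Suc k. S0 i j * f j) + 0" if "i < Suc k" for i
      using S0(2)[OF that] by simp
    have f': "f i \<in> homogeneous_polys (c i)" if "i < Suc k" for i
      using f that by simp
    have S: "alternating (Suc k) S"
      unfolding S_def
      by (rule koszul_syzygy_homogenize(1)[of "Suc k" f c S0 "\<lambda>_. 0" d a'])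
        (fact f' S0(1) S0' hom | rule zero_in_order_ge)+
    have Sa: "a' i = (\<Sum>j<Suc k. S i j * f j)" if "i < Suc k" for i
      unfolding S_def
      by (rule koszul_syzygy_homogenize(2)[of "Suc k" f c S0 "\<lambda>_. 0" d a'])
        (fact f' S0(1) S0' hom that | rule zero_in_order_ge)+
    have a: "a i = (\<Sum>j<k. S i j * f j) + S i k * f k" if "i < k" for i
      using Sa[of i] that by (simp add: a'_def)
    have Sk: "alternating k S" using S by (rule alternating_mono) simp
    show ?case
    proof (cases "c k \<le> d")
      case False
      then have "S i k = 0" for i by (simp add: S_def shifted_component_def)
      then show ?thesis using a Sk unfolding koszul_syzygy_def by auto
    next
      case True
      have "(\<Sum>i<k. S i k * f i) = (\<Sum>i<k. - S k i * f i)"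
      proof (intro sum.cong refl)
        fix i assume "i \<in> {..<k}"
        then have "S i k = - S k i" by (intro alternating_antisym[OF S]) auto
        then show "S i k * f i = - S k i * f i" by simp
      qed
      also have "\<dots> = - (\<Sum>i<k. S k i * f i)" by (simp add: sum_negf)
      also have "(\<Sum>i<k. S k i * f i) = a' k"
        using Sa[of k] alternating_diag[OF S, of k] by simp
      finally have "(\<Sum>i<k. S i k * f i) = 0" by (simp add: a'_def)
      moreover have "shifted_component (d - c k) (c i) (S i k) = S i k" for i
        unfolding S_def shifted_component_add_shift[OF True] by (rule shifted_component_idem)
      ultimately have "koszul_syzygy f k (\<lambda>i. S i k)"
        using less.IH[of "d - c k" "\<lambda>i. S i k"] True ck by simp
      then obtain S' where S': "alternating k S'" "\<And>i. i < k \<Longrightarrow> S i k = (\<Sum>j<k. S' i j * f j)"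
        unfolding koszul_syzygy_def by blast
      have "alternating k (\<lambda>i j. S i j + S' i j * f k)"
        by (rule alternating_add[OF Sk S'(1)])
      moreover have "a i = (\<Sum>j<k. (S i j + S' i j * f k) * f j)" if "i < k" for i
        unfolding a[OF that] S'(2)[OF that]
        by (simp add: algebra_simps sum.distrib sum_distrib_left)
      ultimately show ?thesis unfolding koszul_syzygy_def by blast
    qed
  qed
  then show ?thesis unfolding homogeneous_syzygies_koszul_def by blast
qed

lemma homogeneous_syzygies_koszul_le:
  assumes "homogeneous_syzygies_koszul f c m" and "k \<le> m"
    and f: "\<And>i. i < m \<Longrightarrow> f i \<in> homogeneous_polys (c i)" and c: "\<And>i. i < m \<Longrightarrow> 0 < c i"
  shows "homogeneous_syzygies_koszul f c k"
  using assms(2,1)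
proof (induction rule: inc_induct)
  case (step n)
  show ?case
    by (rule homogeneous_syzygies_koszul_descend) (use step f c in auto)
qed

text \<open>
  If \<open>h f\<^sub>k = \<Sum> b\<^sub>i f\<^sub>i\<close>, then \<open>(-b, h)\<close> is a syzygy. It is Koszul, and the diagonal of an alternating
  matrix vanishes, so its last entry \<open>h\<close> is a combination of the other elements.
\<close>
lemma homogeneous_syzygies_koszul_imp_regular:
  fixes f :: "nat \<Rightarrow> ('n::finite, 'k::field_char_0) mpoly"
  assumes K: "homogeneous_syzygies_koszul f c (Suc k)"
    and f: "\<And>i. i \<le> k \<Longrightarrow> f i \<in> homogeneous_polys (c i)"
    and h: "h \<in> homogeneous_polys e" "h * f k \<in> ideal_span f k"
  shows "h \<in> ideal_span f k"
proof -
  obtain b where b: "h * f k = (\<Sum>i<k. b i * f i)" using h(2) by (auto simp: ideal_span_def)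
  define d where "d = e + c k"
  have hk: "h * f k \<in> homogeneous_polys d"
    unfolding d_def using h(1) f homogeneous_polys_mult by blast
  have "h * f k = homogeneous_component d (\<Sum>i<k. f i * b i)"
    using homogeneous_component_homogeneous[OF hk, of d] b by (simp add: mult.commute)
  also have "\<dots> = (\<Sum>i<k. f i * shifted_component d (c i) (b i))"
    unfolding homogeneous_component_sum
    by (intro sum.cong refl homogeneous_component_mult_left) (simp add: f)
  finally have hf: "h * f k = (\<Sum>i<k. shifted_component d (c i) (b i) * f i)" by (simp add: mult.commute)
  define a where "a i = (if i < k then - shifted_component d (c i) (b i) else h)" for i
  have "koszul_syzygy f (Suc k) a"
  proof (rule K[unfolded homogeneous_syzygies_koszul_def, rule_format])
    show "(\<Sum>i<Suc k. a i * f i) = 0" using hf by (simp add: a_def sum_negf)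
    fix i assume "i < Suc k"
    then show "shifted_component d (c i) (a i) = a i"
      using shifted_component_homogeneous[OF h(1), of "c k"]
      by (auto simp: a_def d_def shifted_component_uminus less_Suc_eq)
  qed
  then obtain S where "alternating (Suc k) S" "a k = (\<Sum>j<Suc k. S k j * f j)"
    unfolding koszul_syzygy_def by blast
  then have "h = (\<Sum>j<k. S k j * f j)"
    using alternating_diag[of "Suc k" S k] by (simp add: a_def)
  then show ?thesis by (rule in_ideal_spanI)
qed

section \<open>Graded characters as quotient traces\<close>

text \<open>
  The hypotheses on \<open>\<pi>\<close> say that the record \<open>V\<close> is a copy of \<open>U/W\<close> with projection \<open>\<pi>\<close>, and \<open>T'\<close> is the map
  induced by \<open>T\<close>. The trace \<open>endo_trace\<close> is taken in a basis obtained by choice. So a basis must be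
  shown to exist, which is the image of a frame of \<open>U/W\<close>, and then an arbitrary basis of \<open>V\<close> is turned
  into a frame by choosing representatives.
\<close>
lemma endo_trace_eq_quotient_trace:
  fixes V :: "('n::finite, 'k::field_char_0, 'w) graded_rep" and \<pi> :: "('n, 'k) mpoly \<Rightarrow> 'w"
  assumes U: "mpoly.subspace U" and W: "mpoly.subspace W" and WU: "W \<subseteq> U"
    and S: "finite S" "U \<subseteq> mpoly.span S"
    and T: "Vector_Spaces.linear (\<lambda>c p. Const c * p) (\<lambda>c p. Const c * p) T" "T ` U \<subseteq> U" "T ` W \<subseteq> W"
    and carrier: "carrier V = \<pi> ` U" and zero: "\<zero>\<^bsub>V\<^esub> = \<pi> 0"
    and add: "\<And>x y. x \<in> U \<Longrightarrow> y \<in> U \<Longrightarrow> \<pi> x \<oplus>\<^bsub>V\<^esub> \<pi> y = \<pi> (x + y)"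
    and smult: "\<And>c x. x \<in> U \<Longrightarrow> c \<odot>\<^bsub>V\<^esub> \<pi> x = \<pi> (Const c * x)"
    and ker: "\<And>x y. x \<in> U \<Longrightarrow> y \<in> U \<Longrightarrow> \<pi> x = \<pi> y \<longleftrightarrow> x - y \<in> W"
    and T': "\<And>x. x \<in> U \<Longrightarrow> T' (\<pi> x) = \<pi> (T x)"
  shows "endo_trace V T' = mpoly.quotient_trace U W T"
proof -
  have U0: "0 \<in> U" by (rule mpoly.subspace_0[OF U])
  have Uadd: "x + y \<in> U" if "x \<in> U" "y \<in> U" for x y using mpoly.subspace_add[OF U that] .
  have Uscale: "Const c * x \<in> U" if "x \<in> U" for c x using mpoly.subspace_scale[OF U that] .
  interpret abelian_monoid V
    by (rule abelian_monoidI) (auto simp: carrier zero add Uadd U0 add_ac)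
  have lincomb: "lincomb V a B = \<pi> (\<Sum>b\<in>B. Const (a b) * e b)"
    and sumU: "(\<Sum>b\<in>B. Const (a b) * e b) \<in> U"
    if "finite B" "\<And>b. b \<in> B \<Longrightarrow> e b \<in> U \<and> \<pi> (e b) = b" for a B e
  proof -
    have "(\<Oplus>\<^bsub>V\<^esub>b\<in>B. a b \<odot>\<^bsub>V\<^esub> b) = \<pi> (\<Sum>b\<in>B. Const (a b) * e b) \<and> (\<Sum>b\<in>B. Const (a b) * e b) \<in> U"
      using that
    proof (induction rule: finite_induct)
      case empty
      then show ?case by (simp add: zero U0)
    next
      case (insert b B)
      have sm: "a b' \<odot>\<^bsub>V\<^esub> b' = \<pi> (Const (a b') * e b')" if "b' \<in> insert b B" for b'
        using smult[of "e b'" "a b'"] insert.prems[of b'] that by simp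
      have "(\<lambda>b. a b \<odot>\<^bsub>V\<^esub> b) \<in> B \<rightarrow> carrier V" "a b \<odot>\<^bsub>V\<^esub> b \<in> carrier V"
        using sm insert.prems Uscale by (auto simp: carrier)
      then have "(\<Oplus>\<^bsub>V\<^esub>b\<in>insert b B. a b \<odot>\<^bsub>V\<^esub> b) = a b \<odot>\<^bsub>V\<^esub> b \<oplus>\<^bsub>V\<^esub> (\<Oplus>\<^bsub>V\<^esub>b\<in>B. a b \<odot>\<^bsub>V\<^esub> b)"
        using insert.hyps by simp
      then show ?case
        using insert sm[of b] add Uadd Uscale by simp
    qed
    then show "lincomb V a B = \<pi> (\<Sum>b\<in>B. Const (a b) * e b)" "(\<Sum>b\<in>B. Const (a b) * e b) \<in> U"
      by (simp_all add: lincomb_def)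
  qed
  have "\<exists>B. finite_basis V B"
  proof -
    obtain C \<kappa> where F: "mpoly.quotient_frame U W C (\<lambda>x. x) \<kappa>"
      using mpoly.quotient_frame_exists[OF U W WU S] by blast
    note d = mpoly.quotient_frameD[OF F]
    have kcong: "\<kappa> c x = \<kappa> c y" if "c \<in> C" "x \<in> U" "y \<in> U" "\<pi> x = \<pi> y" for c x y
      using mpoly.quotient_frame_coord_diff[OF F U that(1-3)] d(5)[OF that(1), of "x - y"] ker that by simp
    have inj: "inj_on \<pi> C"
    proof (rule inj_onI, rule ccontr)
      fix c c' assume c: "c \<in> C" "c' \<in> C" "\<pi> c = \<pi> c'" "c \<noteq> c'"
      then show False using kcong[OF c(1) d(2)[OF c(1)] d(2)[OF c(2)] c(3)] d(6) by simp
    qed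
    let ?e = "inv_into C \<pi>"
    have e: "?e b \<in> U \<and> \<pi> (?e b) = b" if "b \<in> \<pi> ` C" for b
      using that d(2) by (auto simp: inv_into_f_f[OF inj])
    have fin: "finite (\<pi> ` C)" using d(1) by simp
    have reindex: "(\<Sum>b\<in>\<pi> ` C. Const (a b) * ?e b) = (\<Sum>c\<in>C. Const (a (\<pi> c)) * c)" for a
      by (simp add: sum.reindex[OF inj] inv_into_f_f[OF inj])
    have "finite_basis V (\<pi> ` C)"
      unfolding finite_basis_def
    proof (intro conjI ballI fin)
      show "\<pi> ` C \<subseteq> carrier V" using d(2) by (auto simp: carrier)
      fix v assume "v \<in> carrier V"
      then obtain u where u: "u \<in> U" "v = \<pi> u" by (auto simp: carrier)
      let ?a = "\<lambda>b\<in>\<pi> ` C. \<kappa> (?e b) u"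
      have sum_a: "(\<Sum>c\<in>C. Const (?a (\<pi> c)) * c) = (\<Sum>c\<in>C. Const (\<kappa> c u) * c)"
        by (intro sum.cong refl) (simp add: inv_into_f_f[OF inj])
      show "\<exists>!a. a \<in> \<pi> ` C \<rightarrow>\<^sub>E UNIV \<and> v = lincomb V a (\<pi> ` C)"
      proof (rule ex1I[of _ ?a], intro conjI)
        show "?a \<in> \<pi> ` C \<rightarrow>\<^sub>E UNIV" by (rule restrict_PiE[THEN iffD2]) simp
        have "u - (\<Sum>b\<in>\<pi> ` C. Const (?a b) * ?e b) \<in> W"
          unfolding reindex sum_a by (rule d(7)[OF u(1)])
        then have "\<pi> u = \<pi> (\<Sum>b\<in>\<pi> ` C. Const (?a b) * ?e b)"
          using ker[OF u(1) sumU[OF fin e, of ?a]] by blast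
        then show "v = lincomb V ?a (\<pi> ` C)"
          unfolding u(2) by (rule trans[OF _ lincomb[OF fin e, symmetric]])
      next
        fix a assume a: "a \<in> \<pi> ` C \<rightarrow>\<^sub>E UNIV \<and> v = lincomb V a (\<pi> ` C)"
        have v: "\<pi> u = \<pi> (\<Sum>c\<in>C. Const (a (\<pi> c)) * c)"
          using a lincomb[OF fin e, of a] u(2) unfolding reindex by metis
        have sU: "(\<Sum>c\<in>C. Const (a (\<pi> c)) * c) \<in> U"
          using sumU[OF fin e, of a] unfolding reindex .
        show "a = ?a"
        proof (rule PiE_ext)
          show "a \<in> \<pi> ` C \<rightarrow>\<^sub>E UNIV" using a by blast
          show "?a \<in> \<pi> ` C \<rightarrow>\<^sub>E UNIV" by (rule restrict_PiE[THEN iffD2]) simp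
          fix b assume "b \<in> \<pi> ` C"
          then obtain c where c: "c \<in> C" "b = \<pi> c" by blast
          have "\<kappa> c u = \<kappa> c (\<Sum>c'\<in>C. Const (a (\<pi> c')) * c')"
            by (rule kcong[OF c(1) u(1) sU v])
          also have "\<dots> = (\<Sum>c'\<in>C. a (\<pi> c') * \<kappa> c c')"
            by (rule mpoly.quotient_frame_coord_sum[OF F U c(1) d(1) d(2)])
          also have "\<dots> = (\<Sum>c'\<in>C. if c' = c then a (\<pi> c) else 0)"
            using d(6)[OF c(1)] by (intro sum.cong refl) simp
          also have "\<dots> = a b" using c d(1) by simp
          finally show "a b = ?a b" using c by (simp add: inv_into_f_f[OF inj])
        qed
      qed
    qed
    then show ?thesis by blast
  qed
  note ex = this
  \<comment> \<open>\<open>B\<close> is the basis that \<open>endo_trace\<close> selects\<close>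
  define B where "B = (SOME B. finite_basis V B)"
  have basis: "finite_basis V B" unfolding B_def by (rule someI_ex[OF ex])
  have fin: "finite B"
    using basis unfolding finite_basis_def by (elim conjE)
  have sub: "B \<subseteq> carrier V"
    using basis unfolding finite_basis_def by (elim conjE)
  note B = fin sub
  have unique: "\<exists>!a. a \<in> B \<rightarrow>\<^sub>E UNIV \<and> v = lincomb V a B" if "v \<in> carrier V" for v
    using basis that unfolding finite_basis_def by (elim conjE) (erule (1) bspec)
  have piU: "\<pi> u \<in> carrier V" if "u \<in> U" for u
    using that by (simp add: carrier)
  define e where "e = inv_into U \<pi>"
  have e: "e b \<in> U \<and> \<pi> (e b) = b" if "b \<in> B" for b
  proof -
    have "b \<in> \<pi> ` U" using that B(2) carrier by blast
    then show ?thesis unfolding e_def by (simp add: inv_into_into f_inv_into_f)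
  qed
  define \<kappa> where "\<kappa> b u = coords V B (\<pi> u) b" for b u
  have \<kappa>: "\<pi> u = \<pi> (\<Sum>b\<in>B. Const (\<kappa> b u) * e b)" if u: "u \<in> U" for u
  proof -
    have "\<pi> u = lincomb V (coords V B (\<pi> u)) B"
      unfolding coords_def using theI'[OF unique[OF piU[OF u]]] by (rule conjunct2)
    then show ?thesis unfolding \<kappa>_def using lincomb[OF B(1) e, of "coords V B (\<pi> u)"] by (rule trans)
  qed
  have \<kappa>_unique: "\<kappa> b u = a b"
    if u: "u \<in> U" and eq: "\<pi> u = \<pi> (\<Sum>b\<in>B. Const (a b) * e b)" and b: "b \<in> B" for a b u
  proof -
    have "(\<Sum>b\<in>B. Const (restrict a B b) * e b) = (\<Sum>b\<in>B. Const (a b) * e b)"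
      by (rule sum.cong) auto
    then have "\<pi> u = lincomb V (restrict a B) B"
      using eq lincomb[OF B(1) e, of "restrict a B"] by (simp only:)
    moreover have "restrict a B \<in> B \<rightarrow>\<^sub>E UNIV" by simp
    ultimately have "coords V B (\<pi> u) = restrict a B"
      unfolding coords_def by (intro the1_equality[OF unique[OF piU[OF u]]] conjI)
    then show ?thesis using b by (simp add: \<kappa>_def)
  qed
  \<comment> \<open>\<open>s x\<close> is the representative of \<open>\<pi> x\<close> in the span of the chosen vectors \<open>e b\<close>\<close>
  define s where "s x = (\<Sum>b\<in>B. Const (\<kappa> b x) * e b)" for x
  have sU: "s x \<in> U" if "x \<in> U" for x
    unfolding s_def by (rule sumU[OF B(1) e])
  have \<pi>s: "\<pi> x = \<pi> (s x)" if "x \<in> U" for x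
    unfolding s_def by (rule \<kappa>[OF that])
  note s = sU \<pi>s
  have "mpoly.quotient_frame U W B e \<kappa>"
    unfolding mpoly.quotient_frame_def
  proof (intro conjI ballI allI)
    show "finite B" "e ` B \<subseteq> U" using B(1) e by auto
  next
    fix j x y assume j: "j \<in> B" and x: "x \<in> U" and y: "y \<in> U"
    have "\<pi> (x + y) = \<pi> x \<oplus>\<^bsub>V\<^esub> \<pi> y" by (rule add[OF x y, symmetric])
    also have "\<dots> = \<pi> (s x) \<oplus>\<^bsub>V\<^esub> \<pi> (s y)" by (rule arg_cong2[of _ _ _ _ "add V", OF s(2)[OF x] s(2)[OF y]])
    also have "\<dots> = \<pi> (s x + s y)" by (rule add[OF s(1)[OF x] s(1)[OF y]])
    also have "\<dots> = \<pi> (\<Sum>b\<in>B. Const (\<kappa> b x + \<kappa> b y) * e b)"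
      by (rule arg_cong[of _ _ \<pi>]) (simp add: s_def Const_add distrib_right sum.distrib)
    finally have eq: "\<pi> (x + y) = \<pi> (\<Sum>b\<in>B. Const (\<kappa> b x + \<kappa> b y) * e b)" .
    show "\<kappa> j (x + y) = \<kappa> j x + \<kappa> j y" 
      using \<kappa>_unique[of "x + y" "\<lambda>b. \<kappa> b x + \<kappa> b y" j] Uadd[OF x y] eq j by blast
  next
    fix j a x assume j: "j \<in> B" and x: "x \<in> U"
    have "\<pi> (Const a * x) = a \<odot>\<^bsub>V\<^esub> \<pi> x" by (rule smult[OF x, symmetric])
    also have "\<dots> = a \<odot>\<^bsub>V\<^esub> \<pi> (s x)" by (rule arg_cong[of _ _ "smult V a", OF s(2)[OF x]])
    also have "\<dots> = \<pi> (Const a * s x)" by (rule smult[OF s(1)[OF x]])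
    also have "\<dots> = \<pi> (\<Sum>b\<in>B. Const (a * \<kappa> b x) * e b)"
      by (rule arg_cong[of _ _ \<pi>]) (simp only: s_def Const_mult sum_distrib_left mult.assoc)
    finally have eq: "\<pi> (Const a * x) = \<pi> (\<Sum>b\<in>B. Const (a * \<kappa> b x) * e b)" .
    show "\<kappa> j (Const a * x) = a * \<kappa> j x" 
      using \<kappa>_unique[of "Const a * x" "\<lambda>b. a * \<kappa> b x" j] Uscale[OF x] eq j by blast
  next
    fix j x assume j: "j \<in> B" and x: "x \<in> W"
    have "\<pi> x = \<pi> (\<Sum>b\<in>B. Const 0 * e b)" using ker[of x 0] x WU U0 by auto
    then show "\<kappa> j x = 0" using \<kappa>_unique[OF subsetD[OF WU x] _ j, of "\<lambda>_. 0"] by blast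
  next
    fix i j assume i: "i \<in> B" and j: "j \<in> B"
    have "(\<Sum>b\<in>B. Const (if b = j then 1 else 0) * e b) = (\<Sum>b\<in>B. if b = j then e j else 0)"
      by (rule sum.cong) auto
    then have "\<pi> (e j) = \<pi> (\<Sum>b\<in>B. Const (if b = j then 1 else 0) * e b)"
      using j B(1) by simp
    then show "\<kappa> i (e j) = (if i = j then 1 else 0)"
      by (rule \<kappa>_unique[OF conjunct1[OF e[OF j]] _ i, of "\<lambda>b. if b = j then 1 else 0"])
  next
    fix x assume x: "x \<in> U"
    show "x - (\<Sum>j\<in>B. Const (\<kappa> j x) * e j) \<in> W"
      using ker[OF x s(1)[OF x]] s(2)[OF x] unfolding s_def by (rule iffD1)
  qed
  then have "mpoly.quotient_trace U W T = (\<Sum>b\<in>B. \<kappa> b (T (e b)))"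
    by (rule mpoly.quotient_trace_frame[OF _ U WU T])
  also have "\<dots> = (\<Sum>b\<in>B. coords V B (T' b) b)"
  proof (intro sum.cong refl)
    fix b assume "b \<in> B"
    then show "\<kappa> b (T (e b)) = coords V B (T' b) b"
      using T'[of "e b"] e[of b] by (simp add: \<kappa>_def)
  qed
  also have "\<dots> = endo_trace V T'"
    by (simp add: endo_trace_def B_def Let_def)
  finally show ?thesis by simp
qed

definition coset :: "'a::ab_group_add set \<Rightarrow> 'a \<Rightarrow> 'a set" where
  "coset M x = (\<lambda>h. h + x) ` M"

lemma mem_coset: "y \<in> coset M x \<longleftrightarrow> y - x \<in> M"
  unfolding coset_def by (auto intro: image_eqI[of _ _ "y - x"])

lemma coset_eq_iff:
  assumes "mpoly.subspace M"
  shows "coset M x = coset M y \<longleftrightarrow> x - y \<in> M"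
proof
  have "x \<in> coset M x" using mpoly.subspace_0[OF assms] by (simp add: mem_coset)
  moreover assume "coset M x = coset M y"
  ultimately show "x - y \<in> M" by (simp add: mem_coset)
next
  assume xy: "x - y \<in> M"
  have "z - x \<in> M \<longleftrightarrow> z - y \<in> M" for z
    using mpoly.subspace_add[OF assms, of "z - x" "x - y"] mpoly.subspace_diff[OF assms, of "z - y" "x - y"] xy
    by auto
  then show "coset M x = coset M y" by (auto simp: mem_coset)
qed

lemma coset_UN:
  assumes M: "mpoly.subspace M" and T: "\<And>h. h \<in> coset M x \<Longrightarrow> T h - T x \<in> M"
  shows "(\<Union>h\<in>coset M x. coset M (T h)) = coset M (T x)"
proof -
  have "coset M (T h) = coset M (T x)" if "h \<in> coset M x" for h
    using coset_eq_iff[OF M] T[OF that] by simp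
  moreover have "x \<in> coset M x" using mpoly.subspace_0[OF M] by (simp add: mem_coset)
  ultimately show ?thesis by blast
qed

context
  fixes I M :: "('n::finite, 'k::field_char_0) mpoly set"
  assumes M: "mpoly.subspace M"
begin

private lemma a_r_coset: "M +>\<^bsub>sub_rep poly_ring I\<^esub> x = coset M x"
  by (auto simp: a_r_coset_def' sub_rep_def coset_def)

lemma carrier_quot_rep: "carrier (quot_rep (sub_rep poly_ring I) M) = coset M ` I"
  by (auto simp: quot_rep_def A_RCOSETS_def' a_r_coset) (auto simp: sub_rep_def)

lemma gcomp_quot_rep: "gcomp (quot_rep (sub_rep poly_ring I) M) d = coset M ` (I \<inter> homogeneous_polys d)"
  by (simp add: quot_rep_def a_r_coset) (simp add: sub_rep_def)

lemma zero_quot_rep: "\<zero>\<^bsub>quot_rep (sub_rep poly_ring I) M\<^esub> = coset M 0"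
  by (simp add: quot_rep_def coset_def)

lemma add_quot_rep: "coset M x \<oplus>\<^bsub>quot_rep (sub_rep poly_ring I) M\<^esub> coset M y = coset M (x + y)"
proof -
  have "coset M x \<oplus>\<^bsub>quot_rep (sub_rep poly_ring I) M\<^esub> coset M y = {h + k | h k. h \<in> coset M x \<and> k \<in> coset M y}"
    by (auto simp: quot_rep_def set_add_def' sub_rep_def)
  also have "\<dots> = coset M (x + y)"
  proof (intro equalityI subsetI)
    fix z assume "z \<in> {h + k | h k. h \<in> coset M x \<and> k \<in> coset M y}"
    then obtain h k where "z = h + k" "h - x \<in> M" "k - y \<in> M" by (auto simp: mem_coset)
    then show "z \<in> coset M (x + y)"
      using mpoly.subspace_add[OF M, of "h - x" "k - y"] by (simp add: mem_coset algebra_simps)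
  next
    fix z assume "z \<in> coset M (x + y)"
    then have "z - y \<in> coset M x" "y \<in> coset M y" "z = (z - y) + y"
      using mpoly.subspace_0[OF M] by (simp_all add: mem_coset algebra_simps)
    then show "z \<in> {h + k | h k. h \<in> coset M x \<and> k \<in> coset M y}" by blast
  qed
  finally show ?thesis .
qed

lemma smult_quot_rep: "a \<odot>\<^bsub>quot_rep (sub_rep poly_ring I) M\<^esub> coset M x = coset M (Const a * x)"
proof -
  have "a \<odot>\<^bsub>quot_rep (sub_rep poly_ring I) M\<^esub> coset M x = (\<Union>h\<in>coset M x. coset M (Const a * h))"
    by (simp add: quot_rep_def a_r_coset) (simp add: sub_rep_def)
  also have "\<dots> = coset M (Const a * x)"
  proof (rule coset_UN[OF M])
    fix h assume "h \<in> coset M x"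
    then show "Const a * h - Const a * x \<in> M"
      using mpoly.subspace_scale[OF M, of "h - x" a] by (simp add: mem_coset right_diff_distrib)
  qed
  finally show ?thesis .
qed

lemma gact_quot_rep:
  assumes "perm_stable M"
  shows "gact (quot_rep (sub_rep poly_ring I) M) \<sigma> (coset M x) = coset M (perm_vars \<sigma> x)"
proof -
  have "gact (quot_rep (sub_rep poly_ring I) M) \<sigma> (coset M x) = (\<Union>h\<in>coset M x. coset M (perm_vars \<sigma> h))"
    by (simp add: quot_rep_def a_r_coset) (simp add: sub_rep_def)
  also have "\<dots> = coset M (perm_vars \<sigma> x)"
  proof (rule coset_UN[OF M])
    fix h assume "h \<in> coset M x"
    then have "perm_vars \<sigma> (h - x) \<in> M"
      using assms by (simp add: mem_coset perm_stable_def)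
    then show "perm_vars \<sigma> h - perm_vars \<sigma> x \<in> M"
      using perm_vars_add[of \<sigma> "h - x" x] by simp
  qed
  finally show ?thesis .
qed

end

text \<open>
  Lets the description of \<open>quot_rep (sub_rep poly_ring I) M\<close> serve for quotients of the whole ring too.
\<close>
lemma sub_rep_UNIV: "sub_rep poly_ring UNIV = poly_ring"
  by (simp add: sub_rep_def poly_ring_def)

text \<open>
  The character of the degree \<open>d\<close> part of \<open>R/J\<close>. The function given to \<open>Abs_class_fun\<close> is a class function
  as soon as \<open>J\<close> is a stable subspace (\<open>Rep_quotient_character\<close>).
\<close>
definition quotient_character :: "('n::finite, 'k::field_char_0) mpoly set \<Rightarrow> nat \<Rightarrow> ('n, 'k) class_fun" where
  "quotient_character J d =
     Abs_class_fun (\<lambda>\<sigma>. mpoly.quotient_trace (homogeneous_polys d) (J \<inter> homogeneous_polys d) (perm_vars \<sigma>))"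

lemma image_perm_vars_homogeneous:
  "perm_vars \<sigma> ` homogeneous_polys d \<subseteq> homogeneous_polys d"
  using perm_vars_homogeneous by blast

lemma image_perm_vars_Int_homogeneous:
  "perm_stable J \<Longrightarrow> perm_vars \<sigma> ` (J \<inter> homogeneous_polys d) \<subseteq> J \<inter> homogeneous_polys d"
  using perm_vars_homogeneous unfolding perm_stable_def by blast

lemma subspace_Int_homogeneous:
  "mpoly.subspace J \<Longrightarrow> mpoly.subspace (J \<inter> homogeneous_polys d)"
  using mpoly.subspace_inter subspace_homogeneous_polys by blast

text \<open>
  Conjugation invariance: the permutation \<open>\<tau>\<close> is an automorphism of \<open>R\<^sub>d/J\<^sub>d\<close> intertwining \<open>\<sigma>\<close> and
  \<open>\<tau>\<sigma>\<tau>\<^sup>-\<^sup>1\<close>.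
\<close>
lemma Rep_quotient_character:
  fixes J :: "('n::finite, 'k::field_char_0) mpoly set"
  assumes J: "mpoly.subspace J" "perm_stable J"
  shows "Rep_class_fun (quotient_character J d) =
    (\<lambda>\<sigma>. mpoly.quotient_trace (homogeneous_polys d) (J \<inter> homogeneous_polys d) (perm_vars \<sigma>))"
  unfolding quotient_character_def
proof (rule Abs_class_fun_inverse, intro CollectI allI)
  let ?U = "homogeneous_polys d :: ('n, 'k) mpoly set" and ?W = "J \<inter> homogeneous_polys d"
  fix \<sigma> \<tau> :: "'n perm"
  obtain S :: "('n, 'k) mpoly set" where S: "finite S" "?U \<subseteq> mpoly.span S"
    using homogeneous_polys_finitely_spanned by blast
  show "mpoly.quotient_trace ?U ?W (perm_vars (\<tau> * \<sigma> * inverse \<tau>)) = mpoly.quotient_trace ?U ?W (perm_vars \<sigma>)"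
  proof (rule mpoly.quotient_trace_transport[OF subspace_homogeneous_polys subspace_Int_homogeneous[OF J(1)] _ S
        subspace_homogeneous_polys subspace_Int_homogeneous[OF J(1)] _ linear_perm_vars
        image_perm_vars_homogeneous image_perm_vars_Int_homogeneous[OF J(2)] linear_perm_vars
        image_perm_vars_homogeneous image_perm_vars_Int_homogeneous[OF J(2)] linear_perm_vars
        image_perm_vars_homogeneous])
    fix y assume "y \<in> ?U"
    then show "\<exists>x\<in>?U. y - perm_vars \<tau> x \<in> ?W"
      using mpoly.subspace_0[OF subspace_Int_homogeneous[OF J(1)], of d]
      by (intro bexI[of _ "perm_vars (inverse \<tau>) y"]) (simp_all add: perm_vars_homogeneous flip: perm_vars_times)
  next
    fix x assume x: "x \<in> ?U"
    have "perm_vars (inverse \<tau>) (perm_vars \<tau> x) = x" by (simp flip: perm_vars_times)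
    then show "perm_vars \<tau> x \<in> ?W \<longleftrightarrow> x \<in> ?W"
      using x J(2) perm_vars_homogeneous unfolding perm_stable_def by (metis IntD1 IntI)
  next
    fix x show "perm_vars (\<tau> * \<sigma> * inverse \<tau>) (perm_vars \<tau> x) = perm_vars \<tau> (perm_vars \<sigma> x)"
      by (simp add: mult.assoc flip: perm_vars_times)
  qed auto
qed

lemma graded_character_quot_rep:
  fixes J :: "('n::finite, 'k::field_char_0) mpoly set"
  assumes J: "mpoly.subspace J" "perm_stable J"
  shows "graded_character (quot_rep poly_ring J) = Abs_fps (quotient_character J)"
proof -
  have "endo_trace (quot_rep poly_ring J\<lparr>carrier := gcomp (quot_rep poly_ring J) d\<rparr>)
          (gact (quot_rep poly_ring J) \<sigma>) =
        mpoly.quotient_trace (homogeneous_polys d) (J \<inter> homogeneous_polys d) (perm_vars \<sigma>)"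
    (is "endo_trace ?V _ = mpoly.quotient_trace ?U ?W _") for d \<sigma>
  proof -
    obtain S :: "('n, 'k) mpoly set" where S: "finite S" "?U \<subseteq> mpoly.span S"
      using homogeneous_polys_finitely_spanned by blast
    note Q = gcomp_quot_rep[OF J(1), of UNIV] zero_quot_rep[OF J(1), of UNIV] add_quot_rep[OF J(1), of UNIV]
      smult_quot_rep[OF J(1), of UNIV] gact_quot_rep[OF J, of UNIV]
    show ?thesis
    proof (rule endo_trace_eq_quotient_trace[where \<pi> = "coset J", OF subspace_homogeneous_polys
          subspace_Int_homogeneous[OF J(1)] _ S linear_perm_vars image_perm_vars_homogeneous
          image_perm_vars_Int_homogeneous[OF J(2)]])
      fix x y :: "('n, 'k) mpoly" assume "x \<in> ?U" "y \<in> ?U"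
      then show "coset J x = coset J y \<longleftrightarrow> x - y \<in> ?W"
        using coset_eq_iff[OF J(1)] mpoly.subspace_diff[OF subspace_homogeneous_polys] by blast
    qed (simp_all add: Q[unfolded sub_rep_UNIV])
  qed
  then show ?thesis
    by (simp add: graded_character_def rep_character_def quotient_character_def[abs_def])
qed

lemma graded_character_poly_ring:
  "graded_character (poly_ring :: ('n::finite, 'k::field_char_0, ('n, 'k) mpoly) graded_rep)
     = Abs_fps (quotient_character {0})"
proof -
  let ?R = "poly_ring :: ('n, 'k, ('n, 'k) mpoly) graded_rep"
  have J: "mpoly.subspace {0 :: ('n, 'k) mpoly}" "perm_stable {0 :: ('n, 'k) mpoly}"
    by (auto simp: mpoly.subspace_def perm_stable_def)
  have "endo_trace (?R\<lparr>carrier := gcomp ?R d\<rparr>) (gact ?R \<sigma>) =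
        mpoly.quotient_trace (homogeneous_polys d) ({0} \<inter> homogeneous_polys d) (perm_vars \<sigma>)"
    (is "endo_trace ?V _ = mpoly.quotient_trace ?U ?W _") for d \<sigma>
  proof -
    obtain S :: "('n, 'k) mpoly set" where S: "finite S" "?U \<subseteq> mpoly.span S"
      using homogeneous_polys_finitely_spanned by blast
    show ?thesis
    proof (rule endo_trace_eq_quotient_trace[where \<pi> = "\<lambda>x. x", OF subspace_homogeneous_polys
          subspace_Int_homogeneous[OF J(1)] _ S linear_perm_vars image_perm_vars_homogeneous
          image_perm_vars_Int_homogeneous[OF J(2)]])
      fix x y :: "('n, 'k) mpoly" assume "x \<in> ?U" "y \<in> ?U"
      then show "x = y \<longleftrightarrow> x - y \<in> ?W"
        using mpoly.subspace_0[OF subspace_homogeneous_polys] by auto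
    qed simp_all
  qed
  then show ?thesis
    by (simp add: graded_character_def rep_character_def quotient_character_def[abs_def])
qed

lemma quotient_trace_self:
  fixes J :: "('n::finite, 'k::field_char_0) mpoly set"
  assumes "mpoly.subspace J" "Vector_Spaces.linear (\<lambda>c p. Const c * p) (\<lambda>c p. Const c * p) T" "T ` J \<subseteq> J"
  shows "mpoly.quotient_trace J J T = 0"
proof -
  have "mpoly.quotient_frame J J ({} :: nat set) (\<lambda>_. 0) (\<lambda>_ _. 0)"
    by (simp add: mpoly.quotient_frame_def)
  from mpoly.quotient_trace_frame[OF this assms(1) _ assms(2,3,3)] show ?thesis by simp
qed

lemma homogeneous_component_ideal_span:
  assumes f: "\<And>i. i < k \<Longrightarrow> f i \<in> homogeneous_polys (c i)" and "p \<in> ideal_span f k"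
  shows "homogeneous_component d p \<in> ideal_span f k"
proof -
  obtain a where "p = (\<Sum>i<k. f i * a i)"
    using assms(2) by (auto simp: ideal_span_def mult.commute)
  then have "homogeneous_component d p = (\<Sum>i<k. f i * shifted_component d (c i) (a i))"
    by (simp add: homogeneous_component_sum) (intro sum.cong refl homogeneous_component_mult_left, simp add: f)
  then show ?thesis by (intro in_ideal_spanI) (simp add: mult.commute)
qed

lemma ideal_span_Suc_iff:
  "p \<in> ideal_span f (Suc k) \<longleftrightarrow> (\<exists>q a. q \<in> ideal_span f k \<and> p = q + f k * a)"
proof
  assume "p \<in> ideal_span f (Suc k)"
  then obtain a where "p = (\<Sum>i<k. a i * f i) + f k * a k" by (auto simp: ideal_span_def mult.commute)
  then show "\<exists>q a. q \<in> ideal_span f k \<and> p = q + f k * a" by (blast intro: in_ideal_spanI[OF refl])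
next
  assume "\<exists>q a. q \<in> ideal_span f k \<and> p = q + f k * a"
  then obtain b a where "p = (\<Sum>i<k. b i * f i) + f k * a" by (auto simp: ideal_span_def)
  then show "p \<in> ideal_span f (Suc k)"
    by (intro in_ideal_spanI[of _ "b(k := a)"]) (simp add: mult.commute)
qed

lemma perm_stable_ideal_span:
  assumes "\<And>i \<sigma>. i < k \<Longrightarrow> perm_vars \<sigma> (f i) = f i"
  shows "perm_stable (ideal_span f k)"
  unfolding perm_stable_def
proof (intro allI ballI)
  fix \<sigma> p assume "p \<in> ideal_span f k"
  then obtain a where "p = (\<Sum>i<k. a i * f i)" by (auto simp: ideal_span_def)
  then have "perm_vars \<sigma> p = (\<Sum>i<k. perm_vars \<sigma> (a i) * f i)"
    using assms by (simp add: perm_vars_sum perm_vars_mult)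
  then show "perm_vars \<sigma> p \<in> ideal_span f k" by (rule in_ideal_spanI)
qed

text \<open>
  In degree \<open>d\<close>, multiplication by \<open>f k\<close> is an isomorphism from the degree \<open>d - c k\<close> part of
  \<open>R/(f\<^sub>0,\<dots>,f\<^bsub>k-1\<^esub>)\<close> onto the kernel of \<open>R/(f\<^sub>0,\<dots>,f\<^bsub>k-1\<^esub>) \<rightarrow> R/(f\<^sub>0,\<dots>,f\<^sub>k)\<close>: it is injective by regularity, and
  equivariant because \<open>f k\<close> is invariant.
\<close>
lemma quotient_trace_ideal_span_Suc:
  fixes f :: "nat \<Rightarrow> ('n::finite, 'k::field_char_0) mpoly"
  assumes f: "\<And>i. i \<le> k \<Longrightarrow> f i \<in> homogeneous_polys (c i)"
    and inv: "\<And>i \<sigma>. i \<le> k \<Longrightarrow> perm_vars \<sigma> (f i) = f i"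
    and reg: "\<And>e h. h \<in> homogeneous_polys e \<Longrightarrow> h * f k \<in> ideal_span f k \<Longrightarrow> h \<in> ideal_span f k"
  shows "mpoly.quotient_trace (homogeneous_polys d) (ideal_span f k \<inter> homogeneous_polys d) (perm_vars \<sigma>) =
    mpoly.quotient_trace (homogeneous_polys d) (ideal_span f (Suc k) \<inter> homogeneous_polys d) (perm_vars \<sigma>) +
    (if c k \<le> d then mpoly.quotient_trace (homogeneous_polys (d - c k))
       (ideal_span f k \<inter> homogeneous_polys (d - c k)) (perm_vars \<sigma>) else 0)"
proof -
  let ?H = "\<lambda>d. homogeneous_polys d :: ('n, 'k) mpoly set"
  let ?J = "ideal_span f k" and ?J' = "ideal_span f (Suc k)"
  have sub: "mpoly.subspace ?J" "mpoly.subspace ?J'"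
    using ideal_poly_ringD(4)[OF ideal_ideal_span] by blast+
  have stab: "perm_stable ?J" "perm_stable ?J'"
    using inv by (auto intro!: perm_stable_ideal_span)
  have JJ': "?J \<subseteq> ?J'"
  proof
    fix p assume "p \<in> ?J"
    then show "p \<in> ?J'" unfolding ideal_span_Suc_iff by (intro exI[of _ p] exI[of _ 0]) simp
  qed
  obtain S where S: "finite S" "?H d \<subseteq> mpoly.span S"
    using homogeneous_polys_finitely_spanned by blast
  \<comment> \<open>the degree \<open>d\<close> part of \<open>(f\<^sub>0,\<dots>,f\<^sub>k)\<close> is \<open>(f\<^sub>0,\<dots>,f\<^bsub>k-1\<^esub>)\<close> plus multiples of \<open>f\<^sub>k\<close> in that degree\<close>
  have decomp: "y - f k * shifted_component d (c k) a \<in> ?J \<inter> ?H d"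
    if y: "y \<in> ?H d" "y = q + f k * a" "q \<in> ?J" for y q a
  proof -
    have "y = homogeneous_component d y"
      using homogeneous_component_homogeneous[OF y(1), of d] by simp
    also have "\<dots> = homogeneous_component d q + f k * shifted_component d (c k) a"
      unfolding y(2) homogeneous_component_add
      by (simp only: homogeneous_component_mult_left[OF f[OF order_refl]])
    finally have "y = homogeneous_component d q + f k * shifted_component d (c k) a" .
    moreover have "homogeneous_component d q \<in> ?J \<inter> ?H d"
      using homogeneous_component_ideal_span[of k f c q d] f y(3) homogeneous_component_in by auto
    ultimately show ?thesis by simp
  qed
  have "mpoly.quotient_trace (?J' \<inter> ?H d) (?J \<inter> ?H d) (perm_vars \<sigma>) =
    (if c k \<le> d then mpoly.quotient_trace (?H (d - c k)) (?J \<inter> ?H (d - c k)) (perm_vars \<sigma>) else 0)"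
  proof (cases "c k \<le> d")
    case False
    have "y \<in> ?J" if "y \<in> ?J'" "y \<in> ?H d" for y
      using that decomp[OF that(2)] False unfolding ideal_span_Suc_iff
      by (auto simp: shifted_component_def)
    then have "?J' \<inter> ?H d = ?J \<inter> ?H d" using JJ' by blast
    then show ?thesis
      using False quotient_trace_self[OF subspace_Int_homogeneous[OF sub(1)] linear_perm_vars
          image_perm_vars_Int_homogeneous[OF stab(1)]] by simp
  next
    case True
    obtain S' where S': "finite S'" "?H (d - c k) \<subseteq> mpoly.span S'"
      using homogeneous_polys_finitely_spanned by blast
    have fk: "f k * x \<in> ?H d" if "x \<in> ?H (d - c k)" for x
      using homogeneous_polys_mult[OF f[of k] that] True by simp
    have lin: "Vector_Spaces.linear (\<lambda>c p. Const c * p) (\<lambda>c p. Const c * p) (\<lambda>x. f k * x)"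
      by unfold_locales (simp_all add: algebra_simps)
    have "mpoly.quotient_trace (?J' \<inter> ?H d) (?J \<inter> ?H d) (perm_vars \<sigma>) =
      mpoly.quotient_trace (?H (d - c k)) (?J \<inter> ?H (d - c k)) (perm_vars \<sigma>)"
    proof (rule mpoly.quotient_trace_transport[OF subspace_homogeneous_polys subspace_Int_homogeneous[OF sub(1)] _ S'
        subspace_Int_homogeneous[OF sub(2)] subspace_Int_homogeneous[OF sub(1)] _ linear_perm_vars
        image_perm_vars_homogeneous image_perm_vars_Int_homogeneous[OF stab(1)] linear_perm_vars
        image_perm_vars_Int_homogeneous[OF stab(2)] image_perm_vars_Int_homogeneous[OF stab(1)] lin])
      show "(*) (f k) ` ?H (d - c k) \<subseteq> ?J' \<inter> ?H d"
      proof
        fix y assume "y \<in> (*) (f k) ` ?H (d - c k)"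
        then obtain x where x: "x \<in> ?H (d - c k)" "y = f k * x" by blast
        have "y \<in> ?J'" unfolding ideal_span_Suc_iff
          using x mpoly.subspace_0[OF sub(1)] by (intro exI[of _ 0] exI[of _ x]) simp
        then show "y \<in> ?J' \<inter> ?H d" using fk x by simp
      qed
    next
      fix y assume y: "y \<in> ?J' \<inter> ?H d"
      then have "y \<in> ?J'" by blast
      then obtain q a where q: "q \<in> ?J" "y = q + f k * a" unfolding ideal_span_Suc_iff by blast
      have "shifted_component d (c k) a \<in> ?H (d - c k)"
        using True homogeneous_component_in by (simp add: shifted_component_def)
      then show "\<exists>x\<in>?H (d - c k). y - f k * x \<in> ?J \<inter> ?H d"
        using decomp[of y q a] q y by blast
    next
      fix x assume x: "x \<in> ?H (d - c k)"
      have "f k * x \<in> ?J \<longleftrightarrow> x \<in> ?J"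
        using reg[OF x] ideal_poly_ringD(3)[OF ideal_ideal_span, of x f k "f k"] by (auto simp: mult.commute)
      then show "f k * x \<in> ?J \<inter> ?H d \<longleftrightarrow> x \<in> ?J \<inter> ?H (d - c k)"
        using fk x by blast
    next
      fix x show "perm_vars \<sigma> (f k * x) = f k * perm_vars \<sigma> x"
        using inv by (simp add: perm_vars_mult)
    qed (use JJ' in auto)
    then show ?thesis using True by simp
  qed
  moreover have "mpoly.quotient_trace (?H d) (?J \<inter> ?H d) (perm_vars \<sigma>) =
      mpoly.quotient_trace (?H d) (?J' \<inter> ?H d) (perm_vars \<sigma>) +
      mpoly.quotient_trace (?J' \<inter> ?H d) (?J \<inter> ?H d) (perm_vars \<sigma>)"
    by (rule mpoly.quotient_trace_tower[OF subspace_homogeneous_polys subspace_Int_homogeneous[OF sub(2)]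
        subspace_Int_homogeneous[OF sub(1)] _ _ S linear_perm_vars image_perm_vars_homogeneous
        image_perm_vars_Int_homogeneous[OF stab(2)] image_perm_vars_Int_homogeneous[OF stab(1)]])
      (use JJ' in auto)
  ultimately show ?thesis by simp
qed

lemma quotient_character_ideal_span_Suc:
  fixes f :: "nat \<Rightarrow> ('n::finite, 'k::field_char_0) mpoly"
  assumes f: "\<And>i. i \<le> k \<Longrightarrow> f i \<in> homogeneous_polys (c i)"
    and inv: "\<And>i \<sigma>. i \<le> k \<Longrightarrow> perm_vars \<sigma> (f i) = f i"
    and reg: "\<And>e h. h \<in> homogeneous_polys e \<Longrightarrow> h * f k \<in> ideal_span f k \<Longrightarrow> h \<in> ideal_span f k"
  shows "Abs_fps (quotient_character (ideal_span f (Suc k))) =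
     Abs_fps (quotient_character (ideal_span f k)) * (1 - fps_X ^ c k)"
proof (rule fps_ext)
  fix d
  have sub: "mpoly.subspace (ideal_span f j)" for j
    by (rule ideal_poly_ringD(4)[OF ideal_ideal_span])
  have stab: "perm_stable (ideal_span f j)" if "j \<le> Suc k" for j
    using inv that by (auto intro!: perm_stable_ideal_span)
  have "quotient_character (ideal_span f k) d = quotient_character (ideal_span f (Suc k)) d +
      (if c k \<le> d then quotient_character (ideal_span f k) (d - c k) else 0)"
  proof (rule Rep_class_fun_inject[THEN iffD1], rule ext)
    fix \<sigma>
    have trace: "mpoly.quotient_trace (homogeneous_polys d) (ideal_span f k \<inter> homogeneous_polys d) (perm_vars \<sigma>) =
      mpoly.quotient_trace (homogeneous_polys d) (ideal_span f (Suc k) \<inter> homogeneous_polys d) (perm_vars \<sigma>) +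
      (if c k \<le> d then mpoly.quotient_trace (homogeneous_polys (d - c k))
         (ideal_span f k \<inter> homogeneous_polys (d - c k)) (perm_vars \<sigma>) else 0)"
      by (rule quotient_trace_ideal_span_Suc) (fact f inv reg)+
    show "Rep_class_fun (quotient_character (ideal_span f k) d) \<sigma> =
      Rep_class_fun (quotient_character (ideal_span f (Suc k)) d +
      (if c k \<le> d then quotient_character (ideal_span f k) (d - c k) else 0)) \<sigma>"
      using trace by (simp add: plus_class_fun.rep_eq zero_class_fun.rep_eq Rep_quotient_character sub stab)
  qed
  then show "fps_nth (Abs_fps (quotient_character (ideal_span f (Suc k)))) d =
     fps_nth (Abs_fps (quotient_character (ideal_span f k)) * (1 - fps_X ^ c k)) d"
    by (simp add: right_diff_distrib fps_X_power_mult_right_nth)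
qed

section \<open>Invariant minimal generators\<close>

lemma ideal_max_ideal_prod:
  fixes I :: "('n::finite, 'k::field_char_0) mpoly set"
  assumes "ideal I poly_ring"
  shows "ideal (max_ideal \<cdot>\<^bsub>poly_ring\<^esub> I) poly_ring"
proof -
  interpret cring "poly_ring :: ('n, 'k, ('n, 'k) mpoly) graded_rep" by (rule cring_poly_ring)
  show ?thesis
    by (rule ideal_prod_is_ideal[OF _ assms]) (simp add: max_ideal_eq_order_ge ideal_order_ge)
qed

lemma max_ideal_prodI:
  "p \<in> order_ge 1 \<Longrightarrow> q \<in> I \<Longrightarrow> p * q \<in> max_ideal \<cdot>\<^bsub>poly_ring\<^esub> I"
  using ideal_prod.prod[of p max_ideal q I poly_ring] by (simp add: max_ideal_eq_order_ge)

lemma perm_stable_max_ideal_prod: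
  fixes I :: "('n::finite, 'k::field_char_0) mpoly set"
  assumes "perm_stable I"
  shows "perm_stable (max_ideal \<cdot>\<^bsub>poly_ring\<^esub> I)"
  unfolding perm_stable_def
proof (intro allI ballI)
  fix \<sigma> and p :: "('n, 'k) mpoly" assume "p \<in> max_ideal \<cdot>\<^bsub>poly_ring\<^esub> I"
  then show "perm_vars \<sigma> p \<in> max_ideal \<cdot>\<^bsub>poly_ring\<^esub> I"
  proof (induction p rule: ideal_prod.induct)
    case (prod i j)
    then have "perm_vars \<sigma> i * perm_vars \<sigma> j \<in> max_ideal \<cdot>\<^bsub>poly_ring\<^esub> I"
      using assms by (intro max_ideal_prodI) (auto simp: max_ideal_eq_order_ge perm_vars_order_ge perm_stable_def)
    then show ?case by (simp add: perm_vars_mult)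
  next
    case (sum p q)
    then show ?case
      using ideal_prod.sum[of "perm_vars \<sigma> p" poly_ring max_ideal I "perm_vars \<sigma> q"]
      by (simp add: perm_vars_add)
  qed
qed

text \<open>
  An element of \<open>\<mm>\<close> has no component of degree zero, so the degree \<open>d\<close> part of \<open>\<mm>I\<close> is built from
  elements of \<open>I\<close> of degree less than \<open>d\<close>. This is the step of the graded Nakayama lemma.
\<close>
lemma homogeneous_component_max_ideal_prod:
  fixes I J :: "('n::finite, 'k::field_char_0) mpoly set"
  assumes I: "homogeneous_ideal I" and J: "ideal J poly_ring"
    and low: "\<And>e p. e < d \<Longrightarrow> p \<in> I \<Longrightarrow> p \<in> homogeneous_polys e \<Longrightarrow> p \<in> J"
    and p: "p \<in> max_ideal \<cdot>\<^bsub>poly_ring\<^esub> I"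
  shows "homogeneous_component d p \<in> J"
  using p
proof (induction p rule: ideal_prod.induct)
  case (prod i j)
  have "homogeneous_component e i * homogeneous_component (d - e) j \<in> J" if "e \<le> d" for e
  proof (cases "e = 0")
    case True
    have "homogeneous_component 0 i = shifted_component 0 0 i" by (simp add: shifted_component_def)
    also have "\<dots> = 0" using prod(1) by (intro shifted_component_order_ge[of _ 1]) (simp_all add: max_ideal_eq_order_ge)
    finally show ?thesis using True ideal_poly_ringD(1)[OF J] by simp
  next
    case False
    have "homogeneous_component (d - e) j \<in> J"
      using False that prod(2) I
      by (intro low[of "d - e"]) (auto simp: homogeneous_ideal_def homogeneous_component_in)
    then show ?thesis by (rule ideal_poly_ringD(3)[OF J])
  qed
  then have "(\<Sum>e\<le>d. homogeneous_component e i * homogeneous_component (d - e) j) \<in> J"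
    by (intro ideal_sum[OF J]) simp
  then show ?case by (simp add: homogeneous_component_mult)
next
  case (sum p q)
  then show ?case using ideal_poly_ringD(2)[OF J] by (simp add: homogeneous_component_add)
qed

lemma ideal_memberI_components:
  assumes J: "ideal J poly_ring" and p: "\<And>d. homogeneous_component d p \<in> J"
  shows "p \<in> J"
proof -
  have "p = (\<Sum>d\<in>mon_degree ` Poly_Mapping.keys p. homogeneous_component d p)"
  proof (rule poly_mapping_eqI)
    fix a
    show "Poly_Mapping.lookup p a =
      Poly_Mapping.lookup (\<Sum>d\<in>mon_degree ` Poly_Mapping.keys p. homogeneous_component d p) a"
      by (auto simp: lookup_sum lookup_homogeneous_component in_keys_iff)
  qed
  also have "\<dots> \<in> J" using p by (intro ideal_sum[OF J]) simp
  finally show ?thesis .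
qed

text \<open>
  Graded Nakayama lemma, by induction on the degree: after subtracting a combination of the \<open>f i\<close>, an
  element of \<open>I\<close> of degree \<open>d\<close> lies in \<open>\<mm>I\<close> and so comes from lower degrees.
\<close>
lemma lifts_generate_homogeneous_ideal:
  fixes I :: "('n::finite, 'k::field_char_0) mpoly set"
  assumes I: "homogeneous_ideal I"
    and f: "\<And>i. i < m \<Longrightarrow> f i \<in> I \<inter> homogeneous_polys (c i)"
    and span: "\<And>d p. p \<in> I \<inter> homogeneous_polys d \<Longrightarrow>
      \<exists>b. (\<forall>i<m. b i \<noteq> 0 \<longrightarrow> c i = d) \<and> p - (\<Sum>i<m. Const (b i) * f i) \<in> max_ideal \<cdot>\<^bsub>poly_ring\<^esub> I"
  shows "I = ideal_span f m"
proof
  have ideal: "ideal I poly_ring" using I by (simp add: homogeneous_ideal_def)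
  show "ideal_span f m \<subseteq> I"
    unfolding ideal_span_def
    using f by (auto intro!: ideal_sum[OF ideal] ideal_poly_ringD(3)[OF ideal])
  have J: "ideal (ideal_span f m) poly_ring" by (rule ideal_ideal_span)
  have graded: "p \<in> ideal_span f m" if "p \<in> I" "p \<in> homogeneous_polys d" for p d
    using that
  proof (induction d arbitrary: p rule: less_induct)
    case (less d)
    obtain b where b: "\<And>i. i < m \<Longrightarrow> b i \<noteq> 0 \<Longrightarrow> c i = d"
        "p - (\<Sum>i<m. Const (b i) * f i) \<in> max_ideal \<cdot>\<^bsub>poly_ring\<^esub> I"
      using span[of p d] less.prems by blast
    define s where "s = (\<Sum>i<m. Const (b i) * f i)"
    have "Const (b i) * f i \<in> homogeneous_polys d" if "i < m" for i
    proof (cases "b i = 0")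
      case True
      then show ?thesis using mpoly.subspace_0[OF subspace_homogeneous_polys] by simp
    next
      case False
      then have "f i \<in> homogeneous_polys d" using b(1)[OF that] f[OF that] by simp
      then show ?thesis by (rule mpoly.subspace_scale[OF subspace_homogeneous_polys])
    qed
    then have "s \<in> homogeneous_polys d"
      unfolding s_def by (intro mpoly.subspace_sum[OF subspace_homogeneous_polys]) simp
    then have "p - s \<in> homogeneous_polys d"
      using less.prems(2) mpoly.subspace_diff[OF subspace_homogeneous_polys] by blast
    then have "p - s = homogeneous_component d (p - s)"
      using homogeneous_component_homogeneous[of "p - s" d d] by simp
    also have "\<dots> \<in> ideal_span f m"
      using b(2) less.IH unfolding s_def
      by (intro homogeneous_component_max_ideal_prod[OF I J]) auto
    finally have "p - s \<in> ideal_span f m" .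
    moreover have "s \<in> ideal_span f m" unfolding s_def by (rule in_ideal_spanI[OF refl])
    ultimately have "(p - s) + s \<in> ideal_span f m" by (rule ideal_poly_ringD(2)[OF J])
    then show ?case by simp
  qed
  show "I \<subseteq> ideal_span f m"
  proof
    fix p assume "p \<in> I"
    then have "homogeneous_component d p \<in> ideal_span f m" for d
      using I by (intro graded[of _ d]) (auto simp: homogeneous_ideal_def homogeneous_component_in)
    then show "p \<in> ideal_span f m" by (rule ideal_memberI_components[OF J])
  qed
qed

lemma finite_UNIV_perm: "finite (UNIV :: 'n::finite perm set)"
proof (rule finite_imageD)
  show "inj_on apply (UNIV :: 'n perm set)" by (rule inj_onI) (simp add: perm_eq_iff)
qed (rule finite)

text \<open>
  Average over the group. The vector space \<open>V\<close> collects the properties of the translates of \<open>p\<close> that the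
  average has to inherit.
\<close>
lemma invariant_representative:
  fixes M :: "('n::finite, 'k::field_char_0) mpoly set"
  assumes M: "mpoly.subspace M" and p: "\<And>\<sigma>. perm_vars \<sigma> p - p \<in> M"
    and V: "mpoly.subspace V" "\<And>\<sigma>. perm_vars \<sigma> p \<in> V"
  shows "\<exists>q\<in>V. q - p \<in> M \<and> (\<forall>\<sigma>. perm_vars \<sigma> q = q)"
proof -
  let ?G = "UNIV :: 'n perm set"
  define r where "r = inverse (of_nat (card ?G)) * (1 :: 'k)"
  have "card ?G \<noteq> 0" using finite_UNIV_perm[where ?'n = 'n] by (simp add: card_eq_0_iff)
  then have r: "of_nat (card ?G) * r = 1" by (simp add: r_def)
  define q where "q = Const r * (\<Sum>\<sigma>\<in>?G. perm_vars \<sigma> p)"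
  have "q \<in> V" unfolding q_def
    using V by (intro mpoly.subspace_scale[OF V(1)] mpoly.subspace_sum[OF V(1)]) simp
  moreover have "q - p \<in> M"
  proof -
    have "(of_nat (card ?G) :: ('n, 'k) mpoly) = Const (of_nat (card ?G))"
      by (simp add: Const_def)
    then have "Const r * (of_nat (card ?G) * p) = Const (of_nat (card ?G)) * Const r * p"
      by (simp add: mult_ac)
    also have "\<dots> = p"
      by (simp only: Const_mult[symmetric] r Const_1 mult_1)
    finally have "Const r * (of_nat (card ?G) * p) = p" .
    then have "q - p = Const r * (\<Sum>\<sigma>\<in>?G. perm_vars \<sigma> p - p)"
      by (simp add: q_def sum_subtractf right_diff_distrib)
    also have "\<dots> \<in> M"
      using p by (intro mpoly.subspace_scale[OF M] mpoly.subspace_sum[OF M]) simp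
    finally show ?thesis .
  qed
  moreover have "perm_vars \<tau> q = q" for \<tau>
  proof -
    have "(\<Sum>\<sigma>\<in>?G. perm_vars (\<tau> * \<sigma>) p) = (\<Sum>\<sigma>\<in>?G. perm_vars \<sigma> p)"
      by (rule sum.reindex_bij_witness[of _ "\<lambda>\<sigma>. inverse \<tau> * \<sigma>" "\<lambda>\<sigma>. \<tau> * \<sigma>"])
        (simp_all flip: mult.assoc)
    then show ?thesis by (simp add: q_def perm_vars_Const_mult perm_vars_sum perm_vars_times)
  qed
  ultimately show ?thesis by blast
qed

lemma direct_sum_trivial_simps:
  "carrier (direct_sum_rep J (\<lambda>i. trivial_rep (c i))) = J \<rightarrow>\<^sub>E UNIV"
  "x \<oplus>\<^bsub>direct_sum_rep J (\<lambda>i. trivial_rep (c i))\<^esub> y = (\<lambda>j\<in>J. x j + y j)"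
  "a \<odot>\<^bsub>direct_sum_rep J (\<lambda>i. trivial_rep (c i))\<^esub> x = (\<lambda>j\<in>J. a * x j)"
  "gact (direct_sum_rep J (\<lambda>i. trivial_rep (c i))) \<sigma> x = (\<lambda>j\<in>J. x j)"
  "gcomp (direct_sum_rep J (\<lambda>i. trivial_rep (c i))) d = (\<Pi>\<^sub>E j\<in>J. if d = c j then UNIV else {0})"
  by (simp_all add: direct_sum_rep_def trivial_rep_def)

text \<open>
  Composing the isomorphism with the projection gives an equivariant linear map \<open>\<psi>\<close> on \<open>I\<close> with kernel
  \<open>M\<close>. Any homogeneous preimage \<open>p\<close> of a unit vector is invariant modulo \<open>M\<close>, because the target is a trivial
  representation, so its average is an invariant preimage. The remaining two claims say that the lifts
  are a basis of \<open>I/M\<close>; both are read off from \<open>\<psi> (\<Sum> b\<^sub>i f\<^sub>i) = b\<close>.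
\<close>
lemma invariant_lifts:
  fixes I M :: "('n::finite, 'k::field_char_0) mpoly set" and c :: "'i \<Rightarrow> nat"
  assumes M: "mpoly.subspace M" "perm_stable M" and I: "mpoly.subspace I" "perm_stable I" and J: "finite J"
    and iso: "graded_rep_iso (quot_rep (sub_rep poly_ring I) M) (direct_sum_rep J (\<lambda>i. trivial_rep (c i)))"
  shows "\<exists>f. (\<forall>i\<in>J. f i \<in> I \<inter> homogeneous_polys (c i) \<and> (\<forall>\<sigma>. perm_vars \<sigma> (f i) = f i)) \<and>
    (\<forall>b. (\<Sum>i\<in>J. Const (b i) * f i) \<in> M \<longrightarrow> (\<forall>i\<in>J. b i = 0)) \<and>
    (\<forall>d. \<forall>p\<in>I \<inter> homogeneous_polys d. \<exists>b. (\<forall>i\<in>J. b i \<noteq> 0 \<longrightarrow> c i = d) \<and>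
       p - (\<Sum>i\<in>J. Const (b i) * f i) \<in> M)"
proof -
  let ?Q = "quot_rep (sub_rep poly_ring I) M" and ?D = "direct_sum_rep J (\<lambda>i. trivial_rep (c i)) :: ('n, 'k, 'i \<Rightarrow> 'k) graded_rep"
  obtain \<phi> where bij: "bij_betw \<phi> (carrier ?Q) (carrier ?D)"
    and hom: "\<forall>x\<in>carrier ?Q. \<forall>y\<in>carrier ?Q. \<phi> (x \<oplus>\<^bsub>?Q\<^esub> y) = \<phi> x \<oplus>\<^bsub>?D\<^esub> \<phi> y"
      "\<forall>a. \<forall>x\<in>carrier ?Q. \<phi> (a \<odot>\<^bsub>?Q\<^esub> x) = a \<odot>\<^bsub>?D\<^esub> \<phi> x"
      "\<forall>\<sigma>. \<forall>x\<in>carrier ?Q. \<phi> (gact ?Q \<sigma> x) = gact ?D \<sigma> (\<phi> x)"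
      "\<forall>d. \<phi> ` gcomp ?Q d = gcomp ?D d"
    using iso unfolding graded_rep_iso_def by (elim exE conjE) (rule that; assumption)
  note add = hom(1)[rule_format] and smult = hom(2)[rule_format] and act = hom(3)[rule_format]
    and comp = hom(4)[rule_format]
  define \<psi> where "\<psi> p = \<phi> (coset M p)" for p
  have cQ: "coset M p \<in> carrier ?Q" if "p \<in> I" for p
    using that by (simp add: carrier_quot_rep[OF M(1)])
  have \<psi>_carrier: "\<psi> p \<in> J \<rightarrow>\<^sub>E UNIV" if "p \<in> I" for p
    using bij_betw_apply[OF bij cQ[OF that]] by (simp add: \<psi>_def direct_sum_trivial_simps)
  have \<psi>_eq: "\<psi> p = \<psi> q \<longleftrightarrow> p - q \<in> M" if "p \<in> I" "q \<in> I" for p q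
    using inj_on_eq_iff[OF bij_betw_imp_inj_on[OF bij] cQ[OF that(1)] cQ[OF that(2)]]
      coset_eq_iff[OF M(1)] by (simp add: \<psi>_def)
  have \<psi>_add: "\<psi> (p + q) = (\<lambda>j\<in>J. \<psi> p j + \<psi> q j)" if "p \<in> I" "q \<in> I" for p q
    using add[OF cQ[OF that(1)] cQ[OF that(2)]]
    by (simp add: \<psi>_def add_quot_rep[OF M(1)] direct_sum_trivial_simps)
  have \<psi>_scale: "\<psi> (Const a * p) = (\<lambda>j\<in>J. a * \<psi> p j)" if "p \<in> I" for a p
    using smult[OF cQ[OF that], of a]
    by (simp add: \<psi>_def smult_quot_rep[OF M(1)] direct_sum_trivial_simps)
  have \<psi>_act: "\<psi> (perm_vars \<sigma> p) = \<psi> p" if "p \<in> I" for \<sigma> p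
    using act[OF cQ[OF that], of \<sigma>] PiE_restrict[OF \<psi>_carrier[OF that]]
    by (simp add: \<psi>_def gact_quot_rep[OF M] direct_sum_trivial_simps)
  have \<psi>_comp: "\<psi> ` (I \<inter> homogeneous_polys d) = (\<Pi>\<^sub>E j\<in>J. if d = c j then UNIV else {0})" for d
    using comp[of d] by (simp add: \<psi>_def gcomp_quot_rep[OF M(1)] direct_sum_trivial_simps image_image)
  have I0: "0 \<in> I" using mpoly.subspace_0[OF I(1)] .
  define unit where "unit i = (\<lambda>j\<in>J. if j = i then 1 else 0 :: 'k)" for i
  have "\<exists>q. q \<in> I \<inter> homogeneous_polys (c i) \<and> \<psi> q = unit i \<and> (\<forall>\<sigma>. perm_vars \<sigma> q = q)" if "i \<in> J" for i
  proof -
    have "unit i \<in> \<psi> ` (I \<inter> homogeneous_polys (c i))"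
      unfolding \<psi>_comp unit_def by auto
    then obtain p where p: "p \<in> I" "p \<in> homogeneous_polys (c i)" "\<psi> p = unit i" by auto
    let ?V = "I \<inter> homogeneous_polys (c i)"
    have pV: "perm_vars \<sigma> p \<in> ?V" for \<sigma>
      using p I(2) perm_vars_homogeneous by (auto simp: perm_stable_def)
    have "perm_vars \<sigma> p - p \<in> M" for \<sigma>
      using \<psi>_eq[of "perm_vars \<sigma> p" p] \<psi>_act p(1) pV by auto
    from invariant_representative[OF M(1) this subspace_Int_homogeneous[OF I(1)] pV]
    obtain q where q: "q \<in> ?V" "q - p \<in> M" "\<forall>\<sigma>. perm_vars \<sigma> q = q" by auto
    have "\<psi> q = unit i" using \<psi>_eq[of q p] q p by auto
    then show ?thesis using q by blast
  qed
  then have "\<forall>i. \<exists>q. i \<in> J \<longrightarrow> q \<in> I \<inter> homogeneous_polys (c i) \<and> \<psi> q = unit i \<and> (\<forall>\<sigma>. perm_vars \<sigma> q = q)"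
    by blast
  from choice[OF this] obtain f where f: "\<And>i. i \<in> J \<Longrightarrow> f i \<in> I \<inter> homogeneous_polys (c i)"
      "\<And>i. i \<in> J \<Longrightarrow> \<psi> (f i) = unit i" "\<And>i \<sigma>. i \<in> J \<Longrightarrow> perm_vars \<sigma> (f i) = f i"
    by blast
  have fI: "Const a * f i \<in> I" if "i \<in> J" for a i
    using f(1)[OF that] mpoly.subspace_scale[OF I(1)] by blast
  have sumI: "(\<Sum>i\<in>A. Const (b i) * f i) \<in> I" if "A \<subseteq> J" for A b
    using fI that by (intro mpoly.subspace_sum[OF I(1)]) blast
  have \<psi>0: "\<psi> 0 = (\<lambda>j\<in>J. 0)"
    using \<psi>_scale[OF I0, of 0] by simp
  have \<psi>_sum: "\<psi> (\<Sum>i\<in>A. Const (b i) * f i) = (\<lambda>j\<in>J. if j \<in> A then b j else 0)" if "A \<subseteq> J" for A b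
    using finite_subset[OF that J] that
  proof (induction A rule: finite_induct)
    case empty
    show ?case using \<psi>0 by simp
  next
    case (insert i A)
    then have i: "i \<in> J" "A \<subseteq> J" by auto
    have "\<psi> (\<Sum>i\<in>insert i A. Const (b i) * f i) = \<psi> (Const (b i) * f i + (\<Sum>i\<in>A. Const (b i) * f i))"
      using insert.hyps by simp
    also have "\<dots> = (\<lambda>j\<in>J. \<psi> (Const (b i) * f i) j + \<psi> (\<Sum>i\<in>A. Const (b i) * f i) j)"
      by (rule \<psi>_add[OF fI[OF i(1)] sumI[OF i(2)]])
    also have "\<psi> (Const (b i) * f i) = (\<lambda>j\<in>J. b i * unit i j)"
      using \<psi>_scale[of "f i" "b i"] f(1,2)[OF i(1)] by auto
    also have "\<psi> (\<Sum>i\<in>A. Const (b i) * f i) = (\<lambda>j\<in>J. if j \<in> A then b j else 0)"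
      by (rule insert.IH[OF i(2)])
    also have "(\<lambda>j\<in>J. (\<lambda>j\<in>J. b i * unit i j) j + (\<lambda>j\<in>J. if j \<in> A then b j else 0) j) =
        (\<lambda>j\<in>J. if j \<in> insert i A then b j else 0)"
      using insert.hyps by (intro restrict_ext) (auto simp: unit_def)
    finally show ?case .
  qed
  show ?thesis
  proof (intro exI[of _ f] conjI ballI allI impI)
    fix b i assume b: "(\<Sum>i\<in>J. Const (b i) * f i) \<in> M" and i: "i \<in> J"
    have "\<psi> (\<Sum>i\<in>J. Const (b i) * f i) = \<psi> 0"
      using \<psi>_eq[OF sumI[OF order_refl] I0] b by simp
    then have "(\<lambda>j\<in>J. if j \<in> J then b j else 0) = (\<lambda>j\<in>J. 0)"
      using \<psi>_sum[OF order_refl, of b] \<psi>0 by simp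
    from fun_cong[OF this, of i] show "b i = 0" using i by simp
  next
    fix d p assume p: "p \<in> I \<inter> homogeneous_polys d"
    define b where "b = \<psi> p"
    have "b \<in> (\<Pi>\<^sub>E j\<in>J. if d = c j then UNIV else {0})" unfolding b_def \<psi>_comp[symmetric] using p by blast
    then have "c i = d" if "i \<in> J" "b i \<noteq> 0" for i
      using that PiE_mem[of b J "\<lambda>j. if d = c j then UNIV else {0}" i] by (auto split: if_splits)
    moreover have "p - (\<Sum>i\<in>J. Const (b i) * f i) \<in> M"
    proof -
      have "(\<lambda>j\<in>J. if j \<in> J then b j else 0) = (\<lambda>j\<in>J. b j)" by (intro restrict_ext) simp
      also have "\<dots> = \<psi> p" unfolding b_def using p \<psi>_carrier by (intro PiE_restrict) blast
      finally have "\<psi> p = \<psi> (\<Sum>i\<in>J. Const (b i) * f i)" using \<psi>_sum[OF order_refl, of b] by simp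
      then show ?thesis using \<psi>_eq[of p] sumI[OF order_refl] p by blast
    qed
    ultimately show "\<exists>b. (\<forall>i\<in>J. b i \<noteq> 0 \<longrightarrow> c i = d) \<and> p - (\<Sum>i\<in>J. Const (b i) * f i) \<in> M"
      by (intro exI[of _ b]) blast
  qed (use f in auto)
qed

lemma mon_degree_eq_0_iff: "mon_degree a = 0 \<longleftrightarrow> a = 0"
  by (auto simp: mon_degree_def intro!: poly_mapping_eqI)

lemma minus_constant_term_order_ge: "p - Const (Poly_Mapping.lookup p 0) \<in> order_ge 1"
proof -
  have "1 \<le> mon_degree a" if "Poly_Mapping.lookup (p - Const (Poly_Mapping.lookup p 0)) a \<noteq> 0" for a
  proof (rule ccontr)
    assume "\<not> 1 \<le> mon_degree a"
    then have "a = 0" using mon_degree_eq_0_iff[of a] by simp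
    then show False using that by (simp add: lookup_minus Const_def)
  qed
  then show ?thesis by (simp add: order_ge_iff)
qed

text \<open>
  The non-constant parts of the coefficients contribute an element of \<open>\<mm>I\<close>, so the constant terms give a
  linear relation modulo \<open>\<mm>I\<close>.
\<close>
lemma independent_mod_max_ideal_prod_imp_minimal:
  fixes I :: "('n::finite, 'k::field_char_0) mpoly set"
  assumes I: "ideal I poly_ring" and f: "\<And>i. i < m \<Longrightarrow> f i \<in> I"
    and indep: "\<And>b i. (\<Sum>i<m. Const (b i) * f i) \<in> max_ideal \<cdot>\<^bsub>poly_ring\<^esub> I \<Longrightarrow> i < m \<Longrightarrow> b i = 0"
    and syz: "(\<Sum>i<m. a i * f i) = 0" and i: "i < m"
  shows "a i \<in> order_ge 1"
proof -
  define b where "b i = Poly_Mapping.lookup (a i) 0" for i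
  have M: "ideal (max_ideal \<cdot>\<^bsub>poly_ring\<^esub> I) poly_ring" by (rule ideal_max_ideal_prod[OF I])
  have "(\<Sum>i<m. Const (b i) * f i) + (\<Sum>i<m. (a i - Const (b i)) * f i) = 0"
    using syz by (simp add: left_diff_distrib sum_subtractf)
  then have "(\<Sum>i<m. Const (b i) * f i) = (\<Sum>i<m. (- 1) * ((a i - Const (b i)) * f i))"
    by (simp add: sum_negf eq_neg_iff_add_eq_0)
  also have "\<dots> \<in> max_ideal \<cdot>\<^bsub>poly_ring\<^esub> I"
    by (intro ideal_sum[OF M] ideal_poly_ringD(3)[OF M] max_ideal_prodI)
      (use f in \<open>auto simp: b_def intro: minus_constant_term_order_ge[simplified]\<close>)
  finally have "b i = 0" by (rule indep[OF _ i])
  then show ?thesis using minus_constant_term_order_ge[of "a i"] by (simp add: b_def)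
qed

text \<open>
  A nonzero element of degree zero is a unit.
\<close>
lemma proper_ideal_positive_degree:
  fixes I :: "('n::finite, 'k::field_char_0) mpoly set"
  assumes I: "ideal I poly_ring" "I \<noteq> UNIV" and p: "p \<in> I" "p \<in> homogeneous_polys d" "p \<noteq> 0"
  shows "0 < d"
proof (rule ccontr)
  assume "\<not> 0 < d"
  then have p0: "p \<in> homogeneous_polys 0" using p(2) by simp
  define u where "u = Poly_Mapping.lookup p 0"
  have pu: "p = Const u"
  proof (rule poly_mapping_eqI)
    fix a show "Poly_Mapping.lookup p a = Poly_Mapping.lookup (Const u) a"
      using p0 mon_degree_eq_0_iff[of a]
      by (auto simp: homogeneous_polys_iff u_def Const_def lookup_single when_def)
  qed
  then have "u \<noteq> 0" using p(3) by auto
  then have "Const (inverse u) * p = 1" by (simp add: pu flip: Const_mult)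
  then have "1 \<in> I" using ideal_poly_ringD(3)[OF I(1) p(1)] by metis
  then have "x \<in> I" for x using ideal_poly_ringD(3)[OF I(1), of 1 x] by simp
  then show False using I(2) by blast
qed

theorem theorem3p2:
  fixes I :: "('n::finite, 'k::field_char_0) mpoly set"
    and m :: nat
    and c :: "nat \<Rightarrow> nat"
  assumes "homogeneous_ideal I"
    and "perm_stable I"
    and "complete_intersection_ideal poly_ring I"
    and "m \<ge> 1"
    and "graded_rep_iso
           (quot_rep (sub_rep poly_ring I) (max_ideal \<cdot>\<^bsub>poly_ring\<^esub> I))
           (direct_sum_rep {1..m} (\<lambda>i. trivial_rep (c i)))"
  shows "graded_character (quot_rep poly_ring I) =
           graded_character poly_ring * (\<Prod>i=1..m. (1 - fps_X ^ c i))"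
proof -
  let ?M = "max_ideal \<cdot>\<^bsub>poly_ring\<^esub> I"
  have I: "ideal I poly_ring" using assms(1) by (simp add: homogeneous_ideal_def)
  note subI = ideal_poly_ringD(4)[OF I]
  have M: "mpoly.subspace ?M" "perm_stable ?M"
    using ideal_poly_ringD(4)[OF ideal_max_ideal_prod[OF I]] perm_stable_max_ideal_prod[OF assms(2)] .
  obtain f' where f': "\<And>i. i \<in> {1..m} \<Longrightarrow> f' i \<in> I \<inter> homogeneous_polys (c i)"
      "\<And>i \<sigma>. i \<in> {1..m} \<Longrightarrow> perm_vars \<sigma> (f' i) = f' i"
      "\<And>b i. (\<Sum>i\<in>{1..m}. Const (b i) * f' i) \<in> ?M \<Longrightarrow> i \<in> {1..m} \<Longrightarrow> b i = 0"
      "\<And>d p. p \<in> I \<inter> homogeneous_polys d \<Longrightarrow> \<exists>b. (\<forall>i\<in>{1..m}. b i \<noteq> 0 \<longrightarrow> c i = d) \<and>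
         p - (\<Sum>i\<in>{1..m}. Const (b i) * f' i) \<in> ?M"
    using invariant_lifts[OF M subI assms(2) _ assms(5)] by blast
  \<comment> \<open>the generators are renumbered from \<open>0\<close>, to match the indexing of lists and of \<open>ideal_span\<close>\<close>
  define f e where "f i = f' (Suc i)" and "e i = c (Suc i)" for i
  have shift: "(\<Sum>i\<in>{1..m}. g i) = (\<Sum>i<m. g (Suc i))" for g :: "nat \<Rightarrow> ('n, 'k) mpoly"
    by (rule sum.reindex_bij_witness[of _ Suc "\<lambda>i. i - 1"]) auto
  have f: "f i \<in> I \<inter> homogeneous_polys (e i)" if "i < m" for i
    using f'(1)[of "Suc i"] that by (simp add: f_def e_def)
  have inv: "perm_vars \<sigma> (f i) = f i" if "i < m" for i \<sigma>
    using f'(2)[of "Suc i"] that by (simp add: f_def)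
  have indep: "b i = 0" if b: "(\<Sum>i<m. Const (b i) * f i) \<in> ?M" and i: "i < m" for b i
    using f'(3)[of "\<lambda>i. b (i - 1)" "Suc i"] b i unfolding shift by (simp add: f_def)
  have I_eq: "I = ideal_span f m"
  proof (rule lifts_generate_homogeneous_ideal[OF assms(1)])
    fix d p assume "p \<in> I \<inter> homogeneous_polys d"
    from f'(4)[OF this] obtain b where "\<forall>i\<in>{1..m}. b i \<noteq> 0 \<longrightarrow> c i = d"
      "p - (\<Sum>i\<in>{1..m}. Const (b i) * f' i) \<in> ?M" by blast
    then show "\<exists>b. (\<forall>i<m. b i \<noteq> 0 \<longrightarrow> e i = d) \<and> p - (\<Sum>i<m. Const (b i) * f i) \<in> ?M"
      unfolding shift by (intro exI[of _ "\<lambda>i. b (Suc i)"]) (auto simp: f_def e_def)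
  qed (rule f)
  have fI: "f i \<in> I" if "i < m" for i using f[OF that] by blast
  have hom: "f i \<in> homogeneous_polys (e i)" if "i < m" for i using f[OF that] by blast
  obtain gs where gs: "regular_sequence poly_ring gs" "I = Idl\<^bsub>poly_ring\<^esub> (set gs)"
    using assms(3) unfolding complete_intersection_ideal_def by blast
  have span: "ideal_span f m = ideal_span ((!) gs) (length gs)"
    using Idl_poly_ring_take[of "length gs" gs] gs(2) I_eq by simp
  have proper: "I \<noteq> UNIV" using gs unfolding regular_sequence_def by simp
  have pos: "0 < e i" if "i < m" for i
  proof (rule proper_ideal_positive_degree[OF I proper fI[OF that] hom[OF that]])
    show "f i \<noteq> 0"
    proof
      assume "f i = 0"
      then have "(\<Sum>j<m. Const (if j = i then 1 else 0) * f j) = 0"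
        by (intro sum.neutral) auto
      then show False
        using indep[of "\<lambda>j. if j = i then 1 else 0" i] that mpoly.subspace_0[OF M(1)] by simp
    qed
  qed
  have koszul_gs: "koszul_syzygy ((!) gs) (length gs) b" if "(\<Sum>k<length gs. b k * gs ! k) = 0" for b
  proof (rule regular_imp_koszul_syzygy[OF _ that])
    fix i h assume i: "i < length gs" and h: "h * gs ! i \<in> ideal_span ((!) gs) i"
    have "\<forall>i<length gs. \<forall>g. g * gs ! i \<in> Idl\<^bsub>poly_ring\<^esub> (set (take i gs)) \<longrightarrow>
        g \<in> Idl\<^bsub>poly_ring\<^esub> (set (take i gs))"
      using gs(1) unfolding regular_sequence_def by simp
    from this[rule_format, OF i, of h] show "h \<in> ideal_span ((!) gs) i"
      using h Idl_poly_ring_take[of i gs] i by simp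
  qed
  have koszul: "homogeneous_syzygies_koszul f e m"
  proof (rule minimal_generators_syzygies_koszul[OF _ _ span])
    fix b i assume syz: "(\<Sum>i<m. b i * f i) = 0" and i: "i < m"
    show "b i \<in> order_ge 1"
      by (rule independent_mod_max_ideal_prod_imp_minimal[where I = I and m = m and f = f])
        (fact I fI indep syz i)+
  qed (fact koszul_gs hom)+
  have "Abs_fps (quotient_character (ideal_span f k)) =
      Abs_fps (quotient_character (ideal_span f 0)) * (\<Prod>i<k. 1 - fps_X ^ e i)" if "k \<le> m" for k
    using that
  proof (induction k)
    case (Suc k)
    have K: "homogeneous_syzygies_koszul f e (Suc k)"
      by (rule homogeneous_syzygies_koszul_le[OF koszul Suc.prems]) (fact hom pos)+
    have "Abs_fps (quotient_character (ideal_span f (Suc k))) =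
       Abs_fps (quotient_character (ideal_span f k)) * (1 - fps_X ^ e k)"
    proof (rule quotient_character_ideal_span_Suc)
      fix d h assume "h \<in> homogeneous_polys d" "h * f k \<in> ideal_span f k"
      then show "h \<in> ideal_span f k"
        by (rule homogeneous_syzygies_koszul_imp_regular[OF K, rotated]) (use hom Suc.prems in auto)
    qed (use hom inv Suc.prems in auto)
    then show ?case using Suc by (simp add: mult.assoc)
  qed simp
  from this[of m] have "Abs_fps (quotient_character I) =
      Abs_fps (quotient_character {0}) * (\<Prod>i<m. 1 - fps_X ^ e i)"
    using I_eq by (simp add: ideal_span_def)
  moreover have "(\<Prod>i=1..m. 1 - fps_X ^ c i) = (\<Prod>i<m. 1 - fps_X ^ e i :: ('n, 'k) class_fun fps)"
    unfolding e_def by (rule prod.reindex_bij_witness[of _ Suc "\<lambda>i. i - 1"]) auto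
  ultimately show ?thesis
    by (simp only: graded_character_quot_rep[OF subI assms(2)] graded_character_poly_ring)
qed

end
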